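(* Let $\mathcal{A}\subseteq E^\infty$ be an $F_{\sigma\delta}$ set or a $G_{\delta\sigma}$ set. Then there is an infinite-dimensional block subspace $X\subseteq E$ such that either (1) player II has a strategy in the game $A_X$ to play in $E^\infty\setminus\mathcal{A}$, or (2) player I has a strategy in the game $B_X$ to play in $\mathcal{A}$.
   Context: Fix a countable field $\mathfrak F$ and let $E$ be the countable-dimensional $\mathfrak F$-vector space with basis $(e_n)_{n\in\mathbb N}$. For non-zero $x=\sum a_ne_n\in E$, ${\rm supp}\,x=\{n: a_n\neq 0\}$. A finite or infinite sequence $(x_0,x_1,\dots)$ of non-zero vectors is a block sequence if $\max{\rm supp}\,x_n<\min{\rm supp}\,x_{n+1}$ for all $n$. A block subspace is the linear span of an infinite block sequence; throughout, "subspace" (letters $V,W,X,Y,Z$) means an infinite-dimensional block subspace of $E$. For a block subspace $X$ and $k\in\mathbb N$, $X[k]=\{x\in X\setminus\{0\}: k<\min{\rm supp}\,x\}$. $E$ carries the discrete topology and $E^\infty=E^{\mathbb N}$ the product topology (a Polish space). The game $A_V$ (for a block subspace $V$): II plays $n_0\in\mathbb N$; I plays a non-zero vector $x_0\in V[n_0]$ and a block subspace $Z_0\subseteq V$; II plays a non-zero $y_0\in Z_0$ and $n_1\in\mathbb N$; I plays $x_1\in V[n_1]$ and $Z_1\subseteq V$; II plays $y_1\in Z_1$ and $n_2$; and so on. The outcome is $(x_0,y_0,x_1,y_1,\dots)\in E^\infty$. The game $B_V$: II plays a block subspace $Z_0\subseteq V$; I plays a non-zero $x_0\in Z_0$ and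 $n_0\in\mathbb N$; II plays a non-zero $y_0\in V[n_0]$ and a block subspace $Z_1\subseteq V$; I plays $x_1\in Z_1$ and $n_1$; II plays $y_1\in V[n_1]$ and $Z_2$; and so on. The outcome is $(x_0,y_0,x_1,y_1,\dots)$. A player has a strategy to play in a set $\mathcal{B}\subseteq E^\infty$ if he has a strategy such that every outcome of a run in which he follows it lies in $\mathcal B$. *)

theory Defs
  imports "HOL-Analysis.Analysis" "HOL-Library.Countable"
begin

text \<open>Vectors of E are finitely supported sequences nat => F over a countable field F.\<close>

type_synonym 'f vec = "nat \<Rightarrow> 'f"

definition supp :: "'f::zero vec \<Rightarrow> nat set" where
  "supp x = {n. x n \<noteq> 0}"

definition Evec :: "'f::zero vec set" where
  "Evec = {x. finite (supp x)}"

definition block_seq :: "(nat \<Rightarrow> 'f::zero vec) \<Rightarrow> bool" where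
  "block_seq b \<longleftrightarrow> (\<forall>n. b n \<in> Evec \<and> b n \<noteq> (\<lambda>_. 0) \<and> Max (supp (b n)) < Min (supp (b (Suc n))))"

definition seq_span :: "(nat \<Rightarrow> 'f::field vec) \<Rightarrow> 'f vec set" where
  "seq_span b = {v. \<exists>N (c::nat \<Rightarrow> 'f). v = (\<lambda>k. \<Sum>i<N. c i * b i k)}"

definition block_subspace :: "'f::field vec set \<Rightarrow> bool" where
  "block_subspace X \<longleftrightarrow> (\<exists>b. block_seq b \<and> X = seq_span b)"

definition tail_sub :: "'f::zero vec set \<Rightarrow> nat \<Rightarrow> 'f vec set" where
  "tail_sub X k = {x \<in> X. x \<noteq> (\<lambda>_. 0) \<and> k < Min (supp x)}"

definition Einf_top :: "(nat \<Rightarrow> 'f::zero vec) topology" where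
  "Einf_top = product_topology (\<lambda>_. discrete_topology Evec) UNIV"

definition Einf :: "(nat \<Rightarrow> 'f::zero vec) set" where
  "Einf = {s. \<forall>n. s n \<in> Evec}"

definition Fsigma_delta_in :: "'a topology \<Rightarrow> 'a set \<Rightarrow> bool" where
  "Fsigma_delta_in T A \<longleftrightarrow>
     (\<exists>C :: nat \<Rightarrow> nat \<Rightarrow> 'a set. (\<forall>i j. closedin T (C i j)) \<and> A = (\<Inter>i. \<Union>j. C i j))"

definition Gdelta_sigma_in :: "'a topology \<Rightarrow> 'a set \<Rightarrow> bool" where
  "Gdelta_sigma_in T A \<longleftrightarrow>
     (\<exists>U :: nat \<Rightarrow> nat \<Rightarrow> 'a set. (\<forall>i j. openin T (U i j)) \<and> A = (\<Union>i. \<Inter>j. U i j))"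

definition outcome :: "(nat \<Rightarrow> 'a) \<Rightarrow> (nat \<Rightarrow> 'a) \<Rightarrow> nat \<Rightarrow> 'a" where
  "outcome x y m = (if even m then x (m div 2) else y (m div 2))"

text \<open>Game A_V. Player II's strategy: an initial n0 and a map sending the history of I's moves
  [(x0,Z0),...,(xk,Zk)] to II's answer (yk, n_{k+1}).  Player II has a strategy to play in B
  iff, for every run in which I plays legally against it, II's moves are legal and the outcome lies in B.\<close>
definition II_wins_A :: "'f::field vec set \<Rightarrow> (nat \<Rightarrow> 'f vec) set \<Rightarrow> bool" where
  "II_wins_A V B \<longleftrightarrow>
    (\<exists>(n0::nat) (\<sigma> :: ('f vec \<times> 'f vec set) list \<Rightarrow> 'f vec \<times> nat).
      \<forall>(x :: nat \<Rightarrow> 'f vec) (Z :: nat \<Rightarrow> 'f vec set).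
        let hist = (\<lambda>k. map (\<lambda>i. (x i, Z i)) [0..<k]);
            y = (\<lambda>k. fst (\<sigma> (hist (Suc k))));
            n = (\<lambda>k. if k = 0 then n0 else snd (\<sigma> (hist k)))
        in (\<forall>k. x k \<in> tail_sub V (n k) \<and> block_subspace (Z k) \<and> Z k \<subseteq> V) \<longrightarrow>
           ((\<forall>k. y k \<in> Z k \<and> y k \<noteq> (\<lambda>_. 0)) \<and> outcome x y \<in> B))"

text \<open>Game B_V. Player I's strategy: maps II's first move Z0 and the history
  [(y0,Z1),...,(y_{k-1},Zk)] of II's later moves to I's answer (xk, nk).\<close>
definition I_wins_B :: "'f::field vec set \<Rightarrow> (nat \<Rightarrow> 'f vec) set \<Rightarrow> bool" where
  "I_wins_B V B \<longleftrightarrow>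
    (\<exists>\<tau> :: 'f vec set \<Rightarrow> ('f vec \<times> 'f vec set) list \<Rightarrow> 'f vec \<times> nat.
      \<forall>(y :: nat \<Rightarrow> 'f vec) (Z :: nat \<Rightarrow> 'f vec set).
        let mv = (\<lambda>k. \<tau> (Z 0) (map (\<lambda>i. (y i, Z (Suc i))) [0..<k]));
            x = (\<lambda>k. fst (mv k));
            n = (\<lambda>k. snd (mv k))
        in (\<forall>k. block_subspace (Z k) \<and> Z k \<subseteq> V \<and> y k \<in> tail_sub V (n k)) \<longrightarrow>
           ((\<forall>k. x k \<in> Z k \<and> x k \<noteq> (\<lambda>_. 0)) \<and> outcome x y \<in> B))"

end

theory Submission
  imports Defs
begin

text \<open>
  Following de Rancourt, the asymmetric games \<open>A\<^sub>X\<close> and \<open>B\<^sub>X\<close> are compared with the symmetric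
  Kastanas game, in which the players alternately choose vectors and a decreasing (up to tails)
  sequence of subspaces. A winning strategy of either player in that game can be fused, because
  there are only countably many vectors: one diagonalizes over all vectors the players may choose
  to get a subspace \<open>X\<close> on which every subspace move is covered by the recorded ones, and this turns
  the strategy into one for II in \<open>A\<^sub>X\<close> or for I in \<open>B\<^sub>X\<close>. The Kastanas game itself is an ordinary game
  of perfect information on a tree with uncountably many moves, so for \<open>G\<^sub>\<delta>\<^sub>\<sigma>\<close> payoffs it is determined
  by Davis' theorem; exchanging the players gives the \<open>F\<^sub>\<sigma>\<^sub>\<delta>\<close> case.
\<close>

section \<open>Davis' theorem: determinacy for countable unions of \<open>G\<^sub>\<delta>\<close> sets\<close>

text \<open>A fusion over vectors can only store a substitute \<open>Z'\<close> for the subspace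
  \<open>Z\<close> that the opponent really plays. This is harmless: the outcome depends on the
  vectors alone, and the answer lies in the true \<open>Z\<close> because the winning strategy
  permits it after \<open>Z\<close>. The asymmetry of the two games has its origin here. The fused
  \<open>X\<close> is almost contained in every subspace recorded for the winner, so for the loser's
  vectors the subspace constraint shrinks to starting late enough, which is the number
  \<open>n\<close> in \<open>A\<^sub>X\<close> and \<open>B\<^sub>X\<close>; the loser's own
  subspaces remain genuine moves. In the determinacy proof infinitely many restrictions have to be
  imposed along one run. A set of positions can be a strategy of the opponent and at the same time
  the board of the next game, so such restrictions can be nested.\<close>

definition pre :: "(nat \<Rightarrow> 'm) \<Rightarrow> nat \<Rightarrow> 'm list" where
  "pre f n = map f [0..<n]"

lemma length_pre [simp]: "length (pre f n) = n"
  by (simp add: pre_def)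

lemma pre_0 [simp]: "pre f 0 = []"
  by (simp add: pre_def)

lemma pre_Suc: "pre f (Suc n) = pre f n @ [f n]"
  by (simp add: pre_def)

lemma take_pre: "k \<le> n \<Longrightarrow> take k (pre f n) = pre f k"
  by (simp add: pre_def take_map)

text \<open>Strategies are nondeterministic: a subset of the tree \<open>T\<close> of positions that contains some
  successor at the positions in \<open>t\<close> (where the player moves) and all successors elsewhere.
  It may contain positions that are not reachable from the root.\<close>

definition strat :: "('m list \<Rightarrow> bool) \<Rightarrow> 'm list set \<Rightarrow> 'm list set \<Rightarrow> bool" where
  "strat t T S \<longleftrightarrow> S \<subseteq> T \<and>
     (\<forall>q\<in>S. if t q then \<exists>m. q @ [m] \<in> S else \<forall>m. q @ [m] \<in> T \<longrightarrow> q @ [m] \<in> S)"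

definition branches :: "'m list set \<Rightarrow> 'm list \<Rightarrow> (nat \<Rightarrow> 'm) set" where
  "branches S p = {f. pre f (length p) = p \<and> (\<forall>n\<ge>length p. pre f n \<in> S)}"

definition wins :: "('m list \<Rightarrow> bool) \<Rightarrow> 'm list set \<Rightarrow> 'm list \<Rightarrow> (nat \<Rightarrow> 'm) set \<Rightarrow> bool" where
  "wins t T p A \<longleftrightarrow> (\<exists>S. strat t T S \<and> p \<in> S \<and> branches S p \<subseteq> A)"

definition pruned :: "'m list set \<Rightarrow> bool" where
  "pruned T \<longleftrightarrow> (\<forall>q\<in>T. \<exists>m. q @ [m] \<in> T)"

lemma strat_subset: "strat t T S \<Longrightarrow> S \<subseteq> T"
  by (simp add: strat_def)

lemma strat_own: "strat t T S \<Longrightarrow> q \<in> S \<Longrightarrow> t q \<Longrightarrow> \<exists>m. q @ [m] \<in> S"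
  unfolding strat_def by metis

lemma strat_opp: "strat t T S \<Longrightarrow> q \<in> S \<Longrightarrow> \<not> t q \<Longrightarrow> q @ [m] \<in> T \<Longrightarrow> q @ [m] \<in> S"
  unfolding strat_def by metis

lemma strat_trans: "strat t T X \<Longrightarrow> strat t X Y \<Longrightarrow> strat t T Y"
  unfolding strat_def by (meson subset_iff)

lemma strat_pruned: "strat t T S \<Longrightarrow> pruned T \<Longrightarrow> pruned S"
  unfolding strat_def pruned_def by (metis subsetD)

lemma wins_mono: "wins t T p A \<Longrightarrow> A \<subseteq> A' \<Longrightarrow> wins t T p A'"
  unfolding wins_def by blast

lemma wins_trivial:
  assumes "pruned T" "p \<in> T" "\<And>f. pre f (length p) = p \<Longrightarrow> f \<in> A"
  shows "wins t T p A"
  unfolding wins_def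
  by (rule exI[of _ T]) (use assms in \<open>auto simp: strat_def pruned_def branches_def\<close>)

text \<open>Discarding positions with an initial segment outside \<open>S\<close> loses no branch,
  since a branch has all its segments in \<open>S\<close>. Afterwards a shortest position of a given
  kind has its predecessor in the strategy.\<close>

lemma wins_closedE:
  assumes "wins t T p A"
  obtains S where "strat t T S" "p \<in> S" "branches S p \<subseteq> A"
    "\<forall>q\<in>S. length p \<le> length q \<and> take (length p) q = p"
    "\<forall>q\<in>S. \<forall>n\<ge>length p. take n q \<in> S"
proof -
  obtain S where S: "strat t T S" "p \<in> S" "branches S p \<subseteq> A"
    using assms unfolding wins_def by blast
  define S' where "S' = {q. length p \<le> length q \<and> take (length p) q = p \<and> (\<forall>n\<ge>length p. take n q \<in> S)}"
  have sub: "S' \<subseteq> S"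
    unfolding S'_def by (auto dest: spec[of _ "length _"])
  have ext: "q @ [m] \<in> S'" if "q \<in> S'" "q @ [m] \<in> S" for q m
    using that unfolding S'_def by (auto simp: take_Cons')
  show thesis
  proof (rule that[of S'])
    show "strat t T S'"
      unfolding strat_def
    proof (intro conjI ballI)
      show "S' \<subseteq> T" using sub strat_subset[OF S(1)] by blast
      fix q assume q: "q \<in> S'"
      then have "q \<in> S" using sub by blast
      then show "if t q then \<exists>m. q @ [m] \<in> S' else \<forall>m. q @ [m] \<in> T \<longrightarrow> q @ [m] \<in> S'"
        using ext[OF q] strat_own[OF S(1)] strat_opp[OF S(1)] by (simp split: if_splits) blast
    qed
    show "p \<in> S'" using S(2) by (simp add: S'_def)
    show "branches S' p \<subseteq> A"
      using sub S(3) by (auto simp: branches_def)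
  qed (auto simp: S'_def min_def)
qed

text \<open>The state is computed from the position itself, so a strategy with memory is still a
  plain set of positions. Updating starts with the first move after length \<open>k\<close>.\<close>

definition memory :: "('b \<Rightarrow> 'm list \<Rightarrow> 'b) \<Rightarrow> nat \<Rightarrow> 'b \<Rightarrow> 'm list \<Rightarrow> 'b" where
  "memory step k b q = fold (\<lambda>n b. step b (take (Suc n) q)) [k..<length q] b"

lemma memory_start: "length q \<le> k \<Longrightarrow> memory step k b q = b"
  by (simp add: memory_def)

lemma memory_snoc:
  assumes "k \<le> length q"
  shows "memory step k b (q @ [m]) = step (memory step k b q) (q @ [m])"
proof -
  have "fold (\<lambda>n b. step b (take (Suc n) (q @ [m]))) [k..<length q] b
      = fold (\<lambda>n b. step b (take (Suc n) q)) [k..<length q] b"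
    by (rule fold_cong) auto
  then show ?thesis using assms by (simp add: memory_def)
qed

text \<open>Composite strategies switch between given ones; the state \<open>b\<close> records which one is being
  followed.\<close>

lemma wins_memory:
  assumes p: "p \<in> T" "R b0 p"
    and own: "\<And>b q. q \<in> T \<Longrightarrow> R b q \<Longrightarrow> length p \<le> length q \<Longrightarrow> t q \<Longrightarrow>
        \<exists>m. q @ [m] \<in> T \<and> R (step b (q @ [m])) (q @ [m])"
    and opp: "\<And>b q m. q \<in> T \<Longrightarrow> R b q \<Longrightarrow> length p \<le> length q \<Longrightarrow> \<not> t q \<Longrightarrow>
        q @ [m] \<in> T \<Longrightarrow> R (step b (q @ [m])) (q @ [m])"
    and pay: "\<And>f b. pre f (length p) = p \<Longrightarrow> b (length p) = b0 \<Longrightarrow>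
        (\<And>n. length p \<le> n \<Longrightarrow> b (Suc n) = step (b n) (pre f (Suc n))) \<Longrightarrow>
        (\<And>n. length p \<le> n \<Longrightarrow> R (b n) (pre f n)) \<Longrightarrow> f \<in> A"
  shows "wins t T p A"
proof -
  define st where "st = memory step (length p) b0"
  have snoc: "st (q @ [m]) = step (st q) (q @ [m])" if "length p \<le> length q" for q m
    using that by (simp add: st_def memory_snoc)
  define S where "S = {q \<in> T. length p \<le> length q \<and> R (st q) q}"
  show ?thesis
    unfolding wins_def
  proof (intro exI conjI)
    show "strat t T S"
      using own opp snoc unfolding strat_def S_def by auto
    show "p \<in> S" using p by (simp add: S_def st_def memory_start)
    show "branches S p \<subseteq> A"
    proof
      fix f assume f: "f \<in> branches S p"
      show "f \<in> A"
      proof (rule pay[of f "\<lambda>n. st (pre f n)"])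
        show "pre f (length p) = p" using f by (simp add: branches_def)
        then show "st (pre f (length p)) = b0" by (simp add: st_def memory_start)
      next
        fix n assume "length p \<le> n"
        then show "st (pre f (Suc n)) = step (st (pre f n)) (pre f (Suc n))"
          by (simp add: pre_Suc snoc)
        show "R (st (pre f n)) (pre f n)"
          using f \<open>length p \<le> n\<close> by (simp add: branches_def S_def)
      qed
    qed
  qed
qed

text \<open>One round of backward induction: after the first move, the strategy belonging to that
  move is followed. The move can be read off from the position, so the state is trivial.\<close>

lemma wins_step:
  assumes p: "p \<in> T"
    and w: "if t p then \<exists>m. p @ [m] \<in> T \<and> wins t T (p @ [m]) A
            else \<forall>m. p @ [m] \<in> T \<longrightarrow> wins t T (p @ [m]) A"
  shows "wins t T p A"
proof -
  define W where "W = {m. p @ [m] \<in> T \<and> wins t T (p @ [m]) A}"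
  have "\<forall>m\<in>W. \<exists>S. strat t T S \<and> p @ [m] \<in> S \<and> branches S (p @ [m]) \<subseteq> A"
    by (simp add: W_def wins_def)
  then obtain S where S: "\<And>m. m \<in> W \<Longrightarrow> strat t T (S m)" "\<And>m. m \<in> W \<Longrightarrow> p @ [m] \<in> S m"
      "\<And>m. m \<in> W \<Longrightarrow> branches (S m) (p @ [m]) \<subseteq> A"
    by metis
  define R where "R = (\<lambda>(b::unit) q. q = p \<or> (\<exists>m\<in>W. take (Suc (length p)) q = p @ [m] \<and> q \<in> S m))"
  show ?thesis
  proof (rule wins_memory[where R = R and step = "\<lambda>b q. b"])
    show "p \<in> T" "R () p" using p by (simp_all add: R_def)
  next
    fix b q assume q: "q \<in> T" "R b q" "length p \<le> length q" "t q"
    show "\<exists>m. q @ [m] \<in> T \<and> R b (q @ [m])"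
    proof (cases "q = p")
      case True
      then obtain m where "m \<in> W" using w q(4) by (auto simp: W_def)
      then show ?thesis using S(2)[of m] True by (auto simp: R_def W_def)
    next
      case False
      then obtain m where m: "m \<in> W" "take (Suc (length p)) q = p @ [m]" "q \<in> S m"
        using q(2) by (auto simp: R_def)
      then obtain m' where m': "q @ [m'] \<in> S m" using strat_own[OF S(1) m(3) q(4)] by blast
      have "length q \<ge> Suc (length p)" using arg_cong[OF m(2), of length] by simp
      then have "R b (q @ [m'])" using m m' by (auto simp: R_def)
      then show ?thesis using m' strat_subset[OF S(1)[OF m(1)]] by blast
    qed
  next
    fix b q m' assume q: "q \<in> T" "R b q" "length p \<le> length q" "\<not> t q" "q @ [m'] \<in> T"
    show "R b (q @ [m'])"
    proof (cases "q = p")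
      case True
      then have "m' \<in> W" using w q by (auto simp: W_def)
      then show ?thesis using S(2)[of m'] True by (auto simp: R_def W_def)
    next
      case False
      then obtain m where m: "m \<in> W" "take (Suc (length p)) q = p @ [m]" "q \<in> S m"
        using q(2) by (auto simp: R_def)
      then have m': "q @ [m'] \<in> S m" using strat_opp[OF S(1) m(3) q(4,5)] by blast
      have "length q \<ge> Suc (length p)" using arg_cong[OF m(2), of length] by simp
      then show ?thesis using m m' by (auto simp: R_def)
    qed
  next
    fix f :: "nat \<Rightarrow> 'a" and b :: "nat \<Rightarrow> unit"
    assume f: "pre f (length p) = p" "\<And>n. length p \<le> n \<Longrightarrow> R (b n) (pre f n)"
    have *: "f (length p) \<in> W \<and> pre f n \<in> S (f (length p))" if n: "Suc (length p) \<le> n" for n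
    proof -
      have "pre f n \<noteq> p" using n by (metis length_pre not_less_eq_eq order_refl)
      moreover have "take (Suc (length p)) (pre f n) = p @ [f (length p)]"
        using n f(1) by (simp add: take_pre pre_Suc)
      ultimately show ?thesis using f(2)[of n] n by (auto simp: R_def)
    qed
    then have "f (length p) \<in> W" by blast
    moreover have "f \<in> branches (S (f (length p))) (p @ [f (length p)])"
      using * f(1) by (auto simp: branches_def pre_Suc)
    ultimately show "f \<in> A" using S(3) by blast
  qed
qed

section \<open>Positions that the player cannot win\<close>

definition nonlosing :: "('m list \<Rightarrow> bool) \<Rightarrow> 'm list set \<Rightarrow> (nat \<Rightarrow> 'm) set \<Rightarrow> 'm list set" where
  "nonlosing t T A = {q \<in> T. \<not> wins t T q A}"

text \<open>This is \<open>wins_step\<close> read contrapositively: from a position that is not won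
  the player cannot move to a won one, and the opponent can always avoid the won ones.\<close>

lemma strat_nonlosing: "strat (\<lambda>q. \<not> t q) T (nonlosing t T A)"
  unfolding strat_def
proof (intro conjI ballI)
  fix q assume "q \<in> nonlosing t T A"
  then have "q \<in> T" "\<not> wins t T q A" by (auto simp: nonlosing_def)
  then show "if \<not> t q then \<exists>m. q @ [m] \<in> nonlosing t T A
      else \<forall>m. q @ [m] \<in> T \<longrightarrow> q @ [m] \<in> nonlosing t T A"
    using wins_step[of q T t A] by (cases "t q") (auto simp: nonlosing_def)
qed (auto simp: nonlosing_def)

text \<open>A winning strategy inside the smaller tree would extend to \<open>T\<close>: only the
  opponent can leave \<open>?N\<close>, and the exit position is won, so the player switches to a
  winning strategy there.\<close>

lemma nonlosing_not_wins:
  assumes p: "p \<in> nonlosing t T A"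
  shows "\<not> wins t (nonlosing t T A) p A"
proof
  let ?N = "nonlosing t T A"
  assume "wins t ?N p A"
  then obtain S where S: "strat t ?N S" "p \<in> S" "branches S p \<subseteq> A"
    unfolding wins_def by blast
  have "\<forall>q\<in>T - ?N. \<exists>S. strat t T S \<and> q \<in> S \<and> branches S q \<subseteq> A"
    by (auto simp: nonlosing_def wins_def)
  then obtain F where F: "\<And>q. q \<in> T - ?N \<Longrightarrow> strat t T (F q)" "\<And>q. q \<in> T - ?N \<Longrightarrow> q \<in> F q"
      "\<And>q. q \<in> T - ?N \<Longrightarrow> branches (F q) q \<subseteq> A"
    by metis
  \<comment> \<open>\<open>None\<close> means that the run is still in \<open>?N\<close>; the first
    exit position is stored and never overwritten.\<close>
  define step where "step = (\<lambda>s q. case s of None \<Rightarrow> if q \<in> ?N then None else Some q | Some b \<Rightarrow> Some (b :: 'a list))"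
  define R where "R = (\<lambda>s q. case s of None \<Rightarrow> q \<in> S | Some b \<Rightarrow> b \<in> T - ?N \<and> q \<in> F b)"
  have "wins t T p A"
  proof (rule wins_memory[where R = R and step = step])
    show "p \<in> T" "R None p" using p S by (auto simp: R_def nonlosing_def)
  next
    fix b q assume q: "q \<in> T" "R b q" "length p \<le> length q" "t q"
    show "\<exists>m. q @ [m] \<in> T \<and> R (step b (q @ [m])) (q @ [m])"
    proof (cases b)
      case None
      then obtain m where m: "q @ [m] \<in> S"
        using q strat_own[OF S(1)] by (auto simp: R_def)
      then have "q @ [m] \<in> ?N" using strat_subset[OF S(1)] by blast
      then show ?thesis using m None by (auto simp: R_def step_def nonlosing_def)
    next
      case (Some c)
      then have c: "c \<in> T - ?N" "q \<in> F c" using q by (auto simp: R_def)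
      then obtain m where "q @ [m] \<in> F c"
        using q strat_own[OF F(1)] by blast
      then show ?thesis using strat_subset[OF F(1)[OF c(1)]] c Some
        by (auto simp: R_def step_def intro!: exI[of _ m])
    qed
  next
    fix b q m assume q: "q \<in> T" "R b q" "length p \<le> length q" "\<not> t q" "q @ [m] \<in> T"
    show "R (step b (q @ [m])) (q @ [m])"
    proof (cases b)
      case None
      then show ?thesis
        using q F(2)[of "q @ [m]"] strat_opp[OF S(1), of q m] by (auto simp: R_def step_def)
    next
      case (Some c)
      then show ?thesis
        using q strat_opp[OF F(1), of c q m] by (auto simp: R_def step_def)
    qed
  next
    fix f b
    assume f: "pre f (length p) = p" "b (length p) = None"
      "\<And>n. length p \<le> n \<Longrightarrow> b (Suc n) = step (b n) (pre f (Suc n))"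
      "\<And>n. length p \<le> n \<Longrightarrow> R (b n) (pre f n)"
    show "f \<in> A"
    proof (cases "\<forall>n\<ge>length p. b n = None")
      case True
      then have "f \<in> branches S p" using f(1,4) by (auto simp: branches_def R_def)
      then show ?thesis using S(3) by blast
    next
      case False
      define P where "P = (\<lambda>n. length p \<le> n \<and> b n \<noteq> None)"
      define k where "k = (LEAST n. P n)"
      have "\<exists>n. P n" using False by (auto simp: P_def)
      then have k: "P k" "\<And>j. j < k \<Longrightarrow> \<not> P j"
        unfolding k_def by (auto intro: LeastI_ex dest: not_less_Least)
      have "k \<noteq> length p" using k(1) f(2) by (auto simp: P_def)
      then obtain j where j: "k = Suc j" "length p \<le> j" using k(1)
        by (metis P_def Suc_le_mono le_antisym not_less_eq_eq old.nat.exhaust le0)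
      have "b j = None" using k(2)[of j] j by (auto simp: P_def)
      then have bk: "b k = Some (pre f k)"
        using f(3)[OF j(2)] k(1) j by (auto simp: P_def step_def split: if_splits)
      have bn: "b n = Some (pre f k)" if "k \<le> n" for n
        using that
      proof (induction n rule: dec_induct)
        case (step n)
        then show ?case using f(3)[of n] j by (simp add: step_def)
      qed (rule bk)
      have *: "pre f k \<in> T - ?N" "pre f n \<in> F (pre f k)" if "k \<le> n" for n
        using f(4)[of n] bn[of n] that j by (auto simp: R_def)
      then have "f \<in> branches (F (pre f k)) (pre f k)"
        by (auto simp: branches_def)
      then show ?thesis using F(3) *(1) by blast
    qed
  qed
  then show False using p by (simp add: nonlosing_def)
qed

section \<open>Davis' lemma: avoiding a single \<open>G\<^sub>\<delta>\<close> set\<close>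

definition buchi :: "'m list set \<Rightarrow> (nat \<Rightarrow> 'm) set" where
  "buchi Q = {f. \<exists>\<^sub>\<infinity>n. pre f n \<in> Q}"

text \<open>The opponent can restrict the game to \<open>G\<close> so that \<open>B\<close> is
  missed without thereby handing \<open>A\<close> to the player. The last conjunct keeps the game
  alive for avoiding further parts of \<open>A\<close>.\<close>

definition avoidable :: "('m list \<Rightarrow> bool) \<Rightarrow> 'm list set \<Rightarrow> (nat \<Rightarrow> 'm) set \<Rightarrow> (nat \<Rightarrow> 'm) set \<Rightarrow> 'm list \<Rightarrow> bool" where
  "avoidable t T A B q \<longleftrightarrow> (\<exists>G. strat (\<lambda>q. \<not> t q) T G \<and> q \<in> G \<and> branches G q \<inter> B = {} \<and> \<not> wins t G q A)"

text \<open>Davis' auxiliary payoff: besides \<open>A\<close>, the player also accepts to reach a position in \<open>Q\<close> from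
  which the opponent cannot avoid \<open>buchi Q\<close>. There he can restart, and restarting infinitely often
  puts the run into \<open>buchi Q\<close>.\<close>

definition escape :: "('m list \<Rightarrow> bool) \<Rightarrow> 'm list set \<Rightarrow> (nat \<Rightarrow> 'm) set \<Rightarrow> 'm list set \<Rightarrow> 'm list \<Rightarrow> (nat \<Rightarrow> 'm) set" where
  "escape t T A Q p = {f. \<exists>k>length p. pre f k \<in> Q \<and> \<not> avoidable t T A (buchi Q) (pre f k)}"

text \<open>The opponent stays where the enlarged payoff \<open>?E\<close> is not won until the run
  first enters \<open>Q\<close> past \<open>p\<close>, and then follows the witness of avoidability
  for that entry. The entry is avoidable, since otherwise all runs through it would lie in
  \<open>?E\<close>.\<close>

lemma avoidable_if_not_wins_escape:
  assumes T: "pruned T" and p: "p \<in> T" and nw: "\<not> wins t T p (A \<union> escape t T A Q p)"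
  shows "avoidable t T A (buchi Q) p"
proof -
  let ?good = "avoidable t T A (buchi Q)"
  let ?E = "A \<union> escape t T A Q p"
  define N where "N = nonlosing t T ?E"
  have N: "strat (\<lambda>q. \<not> t q) T N" and pN: "p \<in> N"
    using strat_nonlosing[of t T ?E] p nw by (auto simp: N_def nonlosing_def)
  define G where "G = (\<lambda>q. SOME G. strat (\<lambda>q. \<not> t q) T G \<and> q \<in> G \<and>
      branches G q \<inter> buchi Q = {} \<and> \<not> wins t G q A)"
  have "strat (\<lambda>q. \<not> t q) T (G q) \<and> q \<in> G q \<and> branches (G q) q \<inter> buchi Q = {} \<and> \<not> wins t (G q) q A"
    if "?good q" for q
    unfolding G_def using that unfolding avoidable_def by (rule someI_ex)
  then have G: "\<And>q. ?good q \<Longrightarrow> strat (\<lambda>q. \<not> t q) T (G q)" "\<And>q. ?good q \<Longrightarrow> q \<in> G q"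
      "\<And>q. ?good q \<Longrightarrow> branches (G q) q \<inter> buchi Q = {}" "\<And>q. ?good q \<Longrightarrow> \<not> wins t (G q) q A"
    by blast+
  define step where "step = (\<lambda>s q. case s of None \<Rightarrow> if q \<in> Q then Some q else None | Some b \<Rightarrow> Some (b :: 'a list))"
  define R where "R = (\<lambda>s q. case s of None \<Rightarrow> q \<in> N | Some b \<Rightarrow> ?good b \<and> q \<in> G b)"
  define st where "st = memory step (length p) None"
  have snoc: "st (q @ [m]) = step (st q) (q @ [m])" if "length p \<le> length q" for q m
    using that by (simp add: st_def memory_snoc)
  define T' where "T' = {q \<in> T. length p \<le> length q \<and> take (length p) q = p \<and> R (st q) q}"
  have good: "?good q" if q: "q \<in> N" "q \<in> Q" "length p < length q" for q
  proof (rule ccontr)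
    assume "\<not> ?good q"
    then have "wins t T q ?E"
      using q T by (intro wins_trivial) (auto simp: N_def nonlosing_def escape_def)
    then show False using q(1) by (simp add: N_def nonlosing_def)
  qed
  have ext: "q @ [m] \<in> T'" if "q \<in> T'" "q @ [m] \<in> T" "st q = None \<Longrightarrow> q @ [m] \<in> N"
      "\<And>b. st q = Some b \<Longrightarrow> q @ [m] \<in> G b" for q m
  proof (cases "st q")
    case None
    then show ?thesis
      using that good[of "q @ [m]"] G(2)[of "q @ [m]"] by (auto simp: T'_def R_def snoc step_def)
  next
    case (Some b)
    then show ?thesis using that by (auto simp: T'_def R_def snoc step_def)
  qed
  have st': "strat (\<lambda>q. \<not> t q) T T'"
    unfolding strat_def
  proof (intro conjI ballI)
    show "T' \<subseteq> T" by (auto simp: T'_def)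
    fix q assume q: "q \<in> T'"
    then have RR: "q \<in> T" "R (st q) q" by (auto simp: T'_def)
    obtain X where X: "strat (\<lambda>q. \<not> t q) T X" "q \<in> X"
        "\<And>m. q @ [m] \<in> X \<Longrightarrow> q @ [m] \<in> T'"
    proof (cases "st q")
      case None
      then show ?thesis
        using RR ext[OF q] strat_subset[OF N] by (intro that[OF N]) (auto simp: R_def)
    next
      case (Some b)
      then have b: "?good b" "q \<in> G b" using RR by (auto simp: R_def)
      then show ?thesis
        using Some RR ext[OF q] strat_subset[OF G(1)] by (intro that[OF G(1)[OF b(1)]]) (auto simp: R_def)
    qed
    show "if \<not> t q then \<exists>m. q @ [m] \<in> T' else \<forall>m. q @ [m] \<in> T \<longrightarrow> q @ [m] \<in> T'"
      using X(3) strat_own[OF X(1,2)] strat_opp[OF X(1,2)] by (cases "t q") auto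
  qed
  \<comment> \<open>A run in \<open>buchi Q\<close> enters \<open>Q\<close> past \<open>p\<close>;
    from its first entry on it stays in one witness tree, whose branches miss
    \<open>buchi Q\<close>.\<close>
  have av: "branches T' p \<inter> buchi Q = {}"
  proof (rule ccontr)
    assume "branches T' p \<inter> buchi Q \<noteq> {}"
    then obtain f where f: "f \<in> branches T' p" "f \<in> buchi Q" by blast
    have fp: "pre f (length p) = p" using f(1) by (simp add: branches_def)
    have RR: "R (st (pre f n)) (pre f n)" if "n \<ge> length p" for n
      using f(1) that by (auto simp: branches_def T'_def)
    have sn: "st (pre f (Suc n)) = step (st (pre f n)) (pre f (Suc n))" if "n \<ge> length p" for n
      using that by (simp add: pre_Suc snoc)
    define P where "P = (\<lambda>n. length p < n \<and> pre f n \<in> Q)"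
    define k where "k = (LEAST n. P n)"
    have "\<exists>n. P n" using f(2) by (auto simp: buchi_def INFM_nat P_def)
    then have k: "P k" "\<And>j. j < k \<Longrightarrow> \<not> P j"
      unfolding k_def by (auto intro: LeastI_ex dest: not_less_Least)
    have none: "st (pre f j) = None" if "length p \<le> j" "j < k" for j
      using that
    proof (induction j rule: dec_induct)
      case base
      then show ?case by (simp add: st_def memory_start)
    next
      case (step j)
      then show ?case using sn[of j] k(2)[of "Suc j"] by (auto simp: P_def step_def)
    qed
    obtain j where j: "k = Suc j" using k(1) by (cases k) (auto simp: P_def)
    then have sk: "st (pre f k) = Some (pre f k)"
      using none[of j] sn[of j] k(1) by (simp add: P_def step_def)
    have sn': "st (pre f n) = Some (pre f k)" if "k \<le> n" for n
      using that
    proof (induction n rule: dec_induct)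
      case (step n)
      then show ?case using sn[of n] j k(1) by (simp add: step_def P_def)
    qed (rule sk)
    have "?good (pre f k)" "pre f n \<in> G (pre f k)" if "k \<le> n" for n
      using RR[of n] sn'[OF that] that k(1) by (auto simp: R_def P_def)
    then have "?good (pre f k)" "f \<in> branches (G (pre f k)) (pre f k)"
      by (auto simp: branches_def)
    then show False using G(3) f(2) by blast
  qed
  have "\<not> wins t T' p A"
  proof
    assume "wins t T' p A"
    then obtain S where S: "strat t T' S" "p \<in> S" "branches S p \<subseteq> A"
      "\<forall>q\<in>S. length p \<le> length q \<and> take (length p) q = p"
      "\<forall>q\<in>S. \<forall>n\<ge>length p. take n q \<in> S"
      by (rule wins_closedE)
    note ST = strat_subset[OF S(1)]
    \<comment> \<open>If \<open>S\<close> never switches, it is a strategy in \<open>N\<close> and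
      wins a part of \<open>?E\<close>, against \<open>nonlosing_not_wins\<close>. Otherwise a
      shortest switching position \<open>q\<close> has a predecessor in state \<open>None\<close>,
      so it switches exactly at \<open>q\<close>, and the part of \<open>S\<close> above
      \<open>q\<close> would win \<open>A\<close> inside \<open>G q\<close>.\<close>
    show False
    proof (cases "\<exists>q\<in>S. \<exists>b. st q = Some b")
      case False
      then have none: "st q = None" if "q \<in> S" for q using that by auto
      have "strat t N S"
        unfolding strat_def
      proof (intro conjI ballI)
        show "S \<subseteq> N" using none ST by (fastforce simp: T'_def R_def)
        fix q assume q: "q \<in> S"
        show "if t q then \<exists>m. q @ [m] \<in> S else \<forall>m. q @ [m] \<in> N \<longrightarrow> q @ [m] \<in> S"
        proof (cases "t q")
          case True
          then show ?thesis using strat_own[OF S(1) q] by auto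
        next
          case False
          have "q @ [m] \<in> S" if m: "q @ [m] \<in> N" for m
          proof -
            have "q @ [m] \<in> T'"
              using ext[of q m] q none[OF q] ST m strat_subset[OF N] by auto
            then show ?thesis by (rule strat_opp[OF S(1) q False])
          qed
          then show ?thesis using False by simp
        qed
      qed
      then have "wins t N p A" using S by (auto simp: wins_def)
      then have "wins t N p ?E" by (rule wins_mono) simp
      moreover have "\<not> wins t N p ?E"
        using nonlosing_not_wins[of p t T ?E] pN by (simp add: N_def)
      ultimately show False by contradiction
    next
      case True
      define P where "P = (\<lambda>n. \<exists>q\<in>S. length q = n \<and> st q \<noteq> None)"
      define k where "k = (LEAST n. P n)"
      have "\<exists>n. P n" using True by (auto simp: P_def)
      then have k: "P k" "\<And>j. j < k \<Longrightarrow> \<not> P j"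
        unfolding k_def by (auto intro: LeastI_ex dest: not_less_Least)
      obtain q where q: "q \<in> S" "length q = k" "st q \<noteq> None" using k(1) by (auto simp: P_def)
      have "q \<noteq> p" using q(3) by (auto simp: st_def memory_start)
      then obtain q' m where q': "q = q' @ [m]" "length p \<le> length q'"
        using S(4) q(1) by (cases q rule: rev_cases) (auto simp: le_Suc_eq dest!: bspec)
      have "q' \<in> S" using S(5) q(1) q' by (metis append_eq_conv_conj)
      then have "st q' = None" using k(2)[of "length q'"] q(2) q' by (auto simp: P_def)
      then have sq: "st q = Some q" using q' q(3) by (auto simp: snoc step_def split: if_splits)
      have gq: "?good q" using q(1) ST sq by (auto simp: T'_def R_def)
      have lp: "length p \<le> length q" using q' by simp
      define S' where "S' = {r \<in> S. length q \<le> length r \<and> take (length q) r = q}"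
      have sr: "st r = Some q" if "length q \<le> length r" "take (length q) r = q" for r
        using that
      proof (induction r rule: rev_induct)
        case Nil
        then show ?case using sq by simp
      next
        case (snoc m r)
        show ?case
        proof (cases "length q \<le> length r")
          case True
          then have "st (r @ [m]) = step (st r) (r @ [m])" using lp \<open>\<And>q m. length p \<le> length q \<Longrightarrow> st (q @ [m]) = step (st q) (q @ [m])\<close> by simp
          then show ?thesis using snoc True by (simp add: step_def)
        next
          case False
          then have "r @ [m] = q" using snoc.prems by simp
          then show ?thesis using sq by simp
        qed
      qed
      have inG: "r \<in> G q" if "r \<in> S'" for r
        using that sr[of r] ST by (fastforce simp: S'_def T'_def R_def)
      have "strat t (G q) S'"
        unfolding strat_def
      proof (intro conjI ballI)
        show "S' \<subseteq> G q" using inG by blast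
        fix r assume r: "r \<in> S'"
        then have rS: "r \<in> S" by (simp add: S'_def)
        show "if t r then \<exists>m. r @ [m] \<in> S' else \<forall>m. r @ [m] \<in> G q \<longrightarrow> r @ [m] \<in> S'"
        proof (cases "t r")
          case True
          then show ?thesis using strat_own[OF S(1) rS] r by (auto simp: S'_def)
        next
          case False
          have "r @ [m] \<in> S" if m: "r @ [m] \<in> G q" for m
          proof -
            have "r @ [m] \<in> T'"
              using ext[of r m] rS sr[of r] r ST m strat_subset[OF G(1)[OF gq]] by (auto simp: S'_def)
            then show ?thesis by (rule strat_opp[OF S(1) rS False])
          qed
          then show ?thesis using False r by (auto simp: S'_def)
        qed
      qed
      moreover have "q \<in> S'" using q(1) by (simp add: S'_def)
      moreover have "branches S' q \<subseteq> A"
      proof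
        fix f assume f: "f \<in> branches S' q"
        have "pre f n \<in> S" if n: "length p \<le> n" for n
        proof (cases "length q \<le> n")
          case True
          then show ?thesis using f by (auto simp: branches_def S'_def)
        next
          case False
          then have "pre f n = take n q"
            using f take_pre[of n "length q" f] by (simp add: branches_def)
          then show ?thesis using S(5) q(1) n by simp
        qed
        then have "f \<in> branches S p" using f S(4)
          by (auto simp: branches_def dest: bspec[of S _ "pre f (length p)"])
        then show "f \<in> A" using S(3) by blast
      qed
      ultimately have "wins t (G q) q A" by (auto simp: wins_def)
      then show False using G(4)[OF gq] by contradiction
    qed
  qed
  moreover have "p \<in> T'" using p pN by (simp add: T'_def R_def st_def memory_start)
  ultimately show ?thesis using st' av unfolding avoidable_def by (intro exI[of _ T'] conjI)
qed

text \<open>From a position that is not avoidable the player forces \<open>A\<close> or a later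
  position of the same kind in \<open>Q\<close>, where he restarts. Infinitely many restarts give a
  run in \<open>buchi Q\<close>, hence in \<open>A\<close>; after a last restart there is no escape,
  and \<open>A\<close> is left.\<close>

lemma avoidable_if_not_wins:
  assumes T: "pruned T" and p: "p \<in> T" and nw: "\<not> wins t T p A" and B: "buchi Q \<subseteq> A"
  shows "avoidable t T A (buchi Q) p"
proof (rule ccontr)
  let ?good = "avoidable t T A (buchi Q)"
  assume np: "\<not> ?good p"
  have "\<exists>S. strat t T S \<and> q \<in> S \<and> branches S q \<subseteq> A \<union> escape t T A Q q" if "q \<in> T" "\<not> ?good q" for q
    using avoidable_if_not_wins_escape[OF T that(1), of t A Q] that by (auto simp: wins_def)
  then obtain F where F: "\<And>q. q \<in> T \<Longrightarrow> \<not> ?good q \<Longrightarrow> strat t T (F q)"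
      "\<And>q. q \<in> T \<Longrightarrow> \<not> ?good q \<Longrightarrow> q \<in> F q"
      "\<And>q. q \<in> T \<Longrightarrow> \<not> ?good q \<Longrightarrow> branches (F q) q \<subseteq> A \<union> escape t T A Q q"
    by metis
  define step where "step = (\<lambda>b q. if q \<in> Q \<and> \<not> ?good q then q else b)"
  define R where "R = (\<lambda>b q. b \<in> T \<and> \<not> ?good b \<and> q \<in> F b)"
  have "wins t T p A"
  proof (rule wins_memory[where R = R and step = step])
    show "p \<in> T" "R p p" using p np F(2) by (auto simp: R_def)
  next
    fix b q assume q: "q \<in> T" "R b q" "t q"
    then obtain m where "q @ [m] \<in> F b" using strat_own[OF F(1)] by (auto simp: R_def)
    moreover have "F b \<subseteq> T" using strat_subset[OF F(1)] q by (auto simp: R_def)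
    ultimately show "\<exists>m. q @ [m] \<in> T \<and> R (step b (q @ [m])) (q @ [m])"
      using q F(2)[of "q @ [m]"] by (auto simp: R_def step_def intro!: exI[of _ m])
  next
    fix b q m assume q: "q \<in> T" "R b q" "\<not> t q" "q @ [m] \<in> T"
    then have "q @ [m] \<in> F b" using strat_opp[OF F(1)] by (auto simp: R_def)
    then show "R (step b (q @ [m])) (q @ [m])"
      using q F(2)[of "q @ [m]"] by (auto simp: R_def step_def)
  next
    fix f b
    assume f: "pre f (length p) = p" "b (length p) = p"
      "\<And>n. length p \<le> n \<Longrightarrow> b (Suc n) = step (b n) (pre f (Suc n))"
      "\<And>n. length p \<le> n \<Longrightarrow> R (b n) (pre f n)"
    define sw where "sw = (\<lambda>n. n > length p \<and> pre f n \<in> Q \<and> \<not> ?good (pre f n))"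
    show "f \<in> A"
    proof (cases "\<exists>\<^sub>\<infinity>n. sw n")
      case True
      then have "f \<in> buchi Q"
        unfolding buchi_def mem_Collect_eq by (rule frequently_elim1) (simp add: sw_def)
      then show ?thesis using B by blast
    next
      case False
      \<comment> \<open>Counting the beginning as a restart makes \<open>K\<close> nonempty, so
        \<open>Max K\<close> is the time of the last restart in every case.\<close>
      define K where "K = insert (length p) {n. sw n}"
      have "finite K" using False by (simp add: K_def INFM_iff_infinite)
      moreover have "K \<noteq> {}" by (simp add: K_def)
      ultimately have k: "Max K \<in> K" "\<And>n. n \<in> K \<Longrightarrow> n \<le> Max K" by auto
      define k where "k = Max K"
      have kp: "length p \<le> k" using k(2)[of "length p"] by (simp add: k_def K_def)
      have bk: "b k = pre f k"
      proof (cases "k = length p")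
        case False
        then have "sw k" using k(1) by (simp add: k_def K_def)
        moreover obtain j where "k = Suc j" using False kp by (cases k) auto
        ultimately show ?thesis using f(3)[of j] False kp by (simp add: sw_def step_def)
      qed (use f in simp)
      have nsw: "\<not> sw n" if "k < n" for n using k(2)[of n] that by (auto simp: K_def k_def)
      have bn: "b n = pre f k" if "k \<le> n" for n
        using that
      proof (induction n rule: dec_induct)
        case (step n)
        then show ?case using f(3)[of n] kp nsw[of "Suc n"] by (auto simp: step_def sw_def)
      qed (rule bk)
      have *: "pre f k \<in> T" "\<not> ?good (pre f k)" "pre f n \<in> F (pre f k)" if "k \<le> n" for n
        using f(4)[of n] bn[OF that] that kp by (auto simp: R_def)
      then have "f \<in> branches (F (pre f k)) (pre f k)" by (simp add: branches_def)
      then have "f \<in> A \<union> escape t T A Q (pre f k)" using F(3) *(1,2) by blast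
      moreover have "f \<notin> escape t T A Q (pre f k)"
        using nsw kp by (fastforce simp: escape_def sw_def)
      ultimately show ?thesis by blast
    qed
  qed
  then show False using nw by contradiction
qed

text \<open>Passing to the nonlosing positions of \<open>G\<close> makes unwinnability hold at every
  position of \<open>X\<close>, so the step can be repeated inside \<open>X\<close> from any later
  position.\<close>

lemma avoid_step:
  assumes "pruned T" "p \<in> T" "\<not> wins t T p A" "buchi Q \<subseteq> A"
  shows "\<exists>X. strat (\<lambda>q. \<not> t q) T X \<and> p \<in> X \<and> branches X p \<inter> buchi Q = {} \<and> (\<forall>r\<in>X. \<not> wins t X r A)"
proof -
  obtain G where G: "strat (\<lambda>q. \<not> t q) T G" "p \<in> G" "branches G p \<inter> buchi Q = {}" "\<not> wins t G p A"
    using avoidable_if_not_wins[OF assms] by (auto simp: avoidable_def)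
  let ?X = "nonlosing t G A"
  have "strat (\<lambda>q. \<not> t q) T ?X"
    by (rule strat_trans[OF G(1)]) (rule strat_nonlosing)
  moreover have "p \<in> ?X" using G by (simp add: nonlosing_def)
  moreover have "branches ?X p \<inter> buchi Q = {}"
    using G(3) by (auto simp: branches_def nonlosing_def)
  moreover have "\<forall>r\<in>?X. \<not> wins t ?X r A" using nonlosing_not_wins by (rule ballI)
  ultimately show ?thesis by (intro exI[of _ ?X] conjI)
qed

text \<open>The opponent's state is the current tree. Index \<open>0\<close> is dealt with at the
  root, and on arrival at a position of length \<open>n\<close> the tree is shrunk to avoid
  \<open>buchi (Q n)\<close>. The lengths exhaust the indices and the trees decrease, so the run is
  a branch of each of them.\<close>

theorem buchi_union_determined:
  fixes Q :: "nat \<Rightarrow> 'm list set"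
  assumes T: "pruned T" "[] \<in> T" and nw: "\<not> wins t T [] (\<Union>i. buchi (Q i))"
  shows "wins (\<lambda>q. \<not> t q) T [] (- (\<Union>i. buchi (Q i)))"
proof -
  let ?A = "\<Union>i. buchi (Q i)"
  define u where "u = (\<lambda>q. \<not> t q)"
  have u: "u q \<longleftrightarrow> \<not> t q" for q by (simp add: u_def)
  note avoid = avoid_step[where t = t, folded u_def]
  define ok where "ok = (\<lambda>T. pruned T \<and> (\<forall>r\<in>T. \<not> wins t T r ?A))"
  define D where "D = (\<lambda>T p i. SOME X. strat u T X \<and> p \<in> X \<and> branches X p \<inter> buchi (Q i) = {} \<and> ok X)"
  have D: "strat u T (D T p i) \<and> p \<in> D T p i \<and> branches (D T p i) p \<inter> buchi (Q i) = {} \<and> ok (D T p i)"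
    if T: "pruned T" and p: "p \<in> T" "\<not> wins t T p ?A" for T p i
  proof -
    have "buchi (Q i) \<subseteq> ?A" by blast
    from avoid[OF T p this] obtain X where X: "strat u T X" "p \<in> X"
      "branches X p \<inter> buchi (Q i) = {}" "\<forall>r\<in>X. \<not> wins t X r ?A" by (elim exE conjE) (rule that)
    then have "ok X" using strat_pruned[OF X(1) T] by (simp add: ok_def)
    with X have "strat u T X \<and> p \<in> X \<and> branches X p \<inter> buchi (Q i) = {} \<and> ok X" by simp
    then show ?thesis unfolding D_def by (rule someI)
  qed
  \<comment> \<open>The empty tree is a sentinel: \<open>R\<close> fails for it, so \<open>R\<close>
    along a run forces each new position into the preceding tree.\<close>
  define step where "step = (\<lambda>X q. if q \<in> X then D X q (length q) else {})"
  define R where "R = (\<lambda>X q. strat u T X \<and> ok X \<and> q \<in> X)"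
  have stepR: "strat u X (step X q)" "branches (step X q) q \<inter> buchi (Q (length q)) = {}" "R (step X q) q"
    if "strat u T X" "ok X" "q \<in> X" for X q
    using D[of X q "length q"] that strat_trans[of u T X "step X q"] by (auto simp: step_def R_def ok_def)
  note D0 = D[OF T nw, of 0]
  show ?thesis
    unfolding u_def[symmetric]
  proof (rule wins_memory[where R = R and step = step])
    show "[] \<in> T" "R (D T [] 0) []" using T D0 by (auto simp: R_def)
  next
    fix X q assume q: "q \<in> T" "R X q" "u q"
    then obtain m where "q @ [m] \<in> X" using strat_own[of u T X q] by (auto simp: R_def)
    then show "\<exists>m. q @ [m] \<in> T \<and> R (step X (q @ [m])) (q @ [m])"
      using q stepR(3)[of X "q @ [m]"] strat_subset[of u T X] by (auto simp: R_def)
  next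
    fix X q m assume q: "q \<in> T" "R X q" "\<not> u q" "q @ [m] \<in> T"
    then have "q @ [m] \<in> X" using strat_opp[of u T X q] by (auto simp: R_def)
    then show "R (step X (q @ [m])) (q @ [m])"
      using q stepR(3)[of X "q @ [m]"] by (auto simp: R_def)
  next
    fix f X
    assume f: "X (length []) = D T [] 0"
      "\<And>n. length [] \<le> n \<Longrightarrow> X (Suc n) = step (X n) (pre f (Suc n))"
      "\<And>n. length [] \<le> n \<Longrightarrow> R (X n) (pre f n)"
    have R: "strat u T (X n)" "ok (X n)" "pre f n \<in> X n" for n
      using f(3)[of n] by (auto simp: R_def)
    have XS: "X (Suc n) = D (X n) (pre f (Suc n)) (Suc n) \<and> pre f (Suc n) \<in> X n" for n
      using f(2)[of n] R(3)[of "Suc n"] by (auto simp: step_def split: if_splits)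
    have strS: "strat u (X n) (X (Suc n))" "branches (X (Suc n)) (pre f (Suc n)) \<inter> buchi (Q (Suc n)) = {}" for n
      using stepR[OF R(1,2), of "pre f (Suc n)"] XS[of n] by (auto simp: step_def)
    have anti: "X n \<subseteq> X k" if "k \<le> n" for k n
      using that by (induction n rule: dec_induct) (use strat_subset[OF strS(1)] in blast)+
    have "f \<in> branches (X n) (pre f n)" for n
      using R(3) anti by (auto simp: branches_def)
    moreover have "branches (X n) (pre f n) \<inter> buchi (Q n) = {}" for n
      using D0 f(1) strS(2) by (cases n) auto
    ultimately show "f \<in> - ?A" by blast
  qed
qed

text \<open>A \<open>G\<^sub>\<delta>\<close> set is the set of runs that infinitely often enter a new one of the decreasing open
  sets \<open>E j\<close>; the condition \<open>j < length q\<close> delays the entries so that there are infinitely many.\<close>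

lemma buchi_of_open_sets:
  fixes D :: "nat \<Rightarrow> 'm list set"
  assumes up: "\<And>j q m. q \<in> D j \<Longrightarrow> q @ [m] \<in> D j"
  obtains Q where "buchi Q = {f. \<forall>j. \<exists>n. pre f n \<in> D j}"
proof -
  define E where "E = (\<lambda>j. {q. j < length q \<and> (\<forall>i\<le>j. q \<in> D i)})"
  define Q where "Q = {q @ [m] |q m. \<exists>j. q @ [m] \<in> E j \<and> q \<notin> E j}"
  have monoD: "pre f n' \<in> D j" if "n \<le> n'" "pre f n \<in> D j" for f n n' j
    using that by (induction n' rule: dec_induct) (auto simp: pre_Suc up)
  have monoE: "pre f n' \<in> E j" if "n \<le> n'" "pre f n \<in> E j" for f n n' j
    using that monoD[OF that(1)] by (auto simp: E_def)
  have Qpre: "pre f (Suc n) \<in> Q \<longleftrightarrow> (\<exists>j. pre f (Suc n) \<in> E j \<and> pre f n \<notin> E j)" for f n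
    by (auto simp: Q_def pre_Suc)
  have "f \<in> buchi Q \<longleftrightarrow> (\<forall>j. \<exists>n. pre f n \<in> D j)" for f
  proof
    assume "\<forall>j. \<exists>n. pre f n \<in> D j"
    then obtain k where k: "\<And>j. pre f (k j) \<in> D j" by metis
    have "\<exists>n>N. pre f n \<in> Q" for N
    proof -
      define P where "P = (\<lambda>n. pre f n \<in> E N)"
      \<comment> \<open>The sum is a common bound for the entry times of \<open>D 0\<close> to
        \<open>D N\<close>, and \<open>Suc N\<close> makes the position long enough to lie in
        \<open>E N\<close>.\<close>
      define K where "K = Suc N + (\<Sum>i\<le>N. k i)"
      have "pre f K \<in> D i" if "i \<le> N" for i
      proof (rule monoD[OF _ k])
        have "k i \<le> (\<Sum>i\<le>N. k i)" by (rule member_le_sum) (use that in auto)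
        then show "k i \<le> K" by (simp add: K_def)
      qed
      then have "P K" by (auto simp: P_def E_def K_def)
      define l where "l = (LEAST n. P n)"
      have l: "P l" "\<And>j. j < l \<Longrightarrow> \<not> P j"
        using \<open>P K\<close> unfolding l_def by (auto intro: LeastI dest: not_less_Least)
      have "N < l" using l(1) by (simp add: P_def E_def)
      moreover obtain l' where "l = Suc l'" using \<open>N < l\<close> by (cases l) auto
      ultimately have "pre f l \<in> Q" using l(1) l(2)[of l'] Qpre[of f l'] by (auto simp: P_def)
      with \<open>N < l\<close> show ?thesis by blast
    qed
    then show "f \<in> buchi Q" by (simp add: buchi_def INFM_nat)
  next
    assume f: "f \<in> buchi Q"
    show "\<forall>j. \<exists>n. pre f n \<in> D j"
    proof (rule ccontr)
      assume "\<not> ?thesis"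
      then obtain j0 where j0: "\<And>n. pre f n \<notin> D j0" by blast
      define M where "M = {n. pre f n \<in> Q}"
      have M0: "\<exists>k j. n = Suc k \<and> pre f n \<in> E j \<and> pre f k \<notin> E j" if "n \<in> M" for n
        using that Qpre by (cases n) (auto simp: M_def Q_def)
      then have "\<forall>n\<in>M. \<exists>j. \<exists>k. n = Suc k \<and> pre f n \<in> E j \<and> pre f k \<notin> E j" by blast
      \<comment> \<open>\<open>g n\<close> is the index of a set entered at time \<open>n\<close>.
        As \<open>E j\<close> is never left again, distinct times have distinct indices, and all of
        them are below \<open>j0\<close>.\<close>
      then obtain g where g: "\<And>n. n \<in> M \<Longrightarrow> \<exists>k. n = Suc k \<and> pre f n \<in> E (g n) \<and> pre f k \<notin> E (g n)"
        by metis
      have neq: "g n1 \<noteq> g n2" if n: "n1 \<in> M" "n2 \<in> M" "n1 < n2" for n1 n2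
      proof
        assume eq: "g n1 = g n2"
        obtain k where k: "n2 = Suc k" "pre f k \<notin> E (g n2)" using g[OF n(2)] by blast
        have "pre f n1 \<in> E (g n2)" using g[OF n(1)] eq by auto
        then have "pre f k \<in> E (g n2)" using monoE[of n1 k f] n(3) k(1) by simp
        then show False using k(2) by contradiction
      qed
      have "inj_on g M" by (rule inj_onI) (metis neq nat_neq_iff)
      moreover have "g ` M \<subseteq> {..<j0}"
      proof
        fix j assume "j \<in> g ` M"
        then obtain n where "n \<in> M" "j = g n" by blast
        then have "pre f n \<in> E j" using g by blast
        then show "j \<in> {..<j0}" using j0[of n] by (metis (no_types, lifting) E_def lessThan_iff mem_Collect_eq not_less)
      qed
      ultimately have "finite M" by (meson finite_imageD finite_lessThan finite_subset)
      then show False using f by (simp add: M_def buchi_def INFM_iff_infinite)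
    qed
  qed
  then show thesis by (intro that[of Q]) auto
qed

theorem Sigma03_determined:
  fixes D :: "nat \<Rightarrow> nat \<Rightarrow> 'm list set"
  assumes T: "pruned T" "[] \<in> T"
    and up: "\<And>i j q m. q \<in> D i j \<Longrightarrow> q @ [m] \<in> D i j"
    and W: "W = {f. \<exists>i. \<forall>j. \<exists>n. pre f n \<in> D i j}"
  shows "wins t T [] W \<or> wins (\<lambda>q. \<not> t q) T [] (- W)"
proof -
  have "\<exists>Q. buchi Q = {f. \<forall>j. \<exists>n. pre f n \<in> D i j}" for i
    using buchi_of_open_sets[of "D i"] up by metis
  then obtain Q where Q: "\<And>i. buchi (Q i) = {f. \<forall>j. \<exists>n. pre f n \<in> D i j}" by metis
  have "W = (\<Union>i. buchi (Q i))" by (auto simp: W Q)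
  then show ?thesis using buchi_union_determined[OF T, of t Q] by blast
qed

section \<open>Almost containment of block subspaces\<close>

definition almost_sub :: "'f::zero vec set \<Rightarrow> 'f vec set \<Rightarrow> bool" where
  "almost_sub X Y \<longleftrightarrow> (\<exists>m. tail_sub X m \<subseteq> Y)"

lemma almost_sub_subset: "X \<subseteq> Y \<Longrightarrow> almost_sub X Y"
  by (auto simp: almost_sub_def tail_sub_def)

lemma almost_sub_trans:
  assumes "almost_sub X Y" "almost_sub Y Z" shows "almost_sub X Z"
proof -
  obtain m k where "tail_sub X m \<subseteq> Y" "tail_sub Y k \<subseteq> Z"
    using assms by (auto simp: almost_sub_def)
  then have "tail_sub X (max m k) \<subseteq> Z" by (auto simp: tail_sub_def)
  then show ?thesis by (auto simp: almost_sub_def)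
qed

lemma block_seqD:
  assumes "block_seq b"
  shows "finite (supp (b n))" "supp (b n) \<noteq> {}" "b n \<noteq> (\<lambda>_. 0)" "Max (supp (b n)) < Min (supp (b (Suc n)))"
  using assms by (auto simp: block_seq_def Evec_def supp_def fun_eq_iff)

lemma block_seq_less:
  assumes b: "block_seq b" and "i < j"
  shows "Max (supp (b i)) < Min (supp (b j))"
proof -
  have "Min (supp (b n)) \<le> Max (supp (b n))" for n
    using block_seqD(1,2)[OF b] by (meson Max_ge Min_in)
  then have step: "Max (supp (b n)) < Min (supp (b (Suc k)))" if "Max (supp (b n)) < Min (supp (b k))" for n k
    using that block_seqD(4)[OF b, of k] by (meson less_trans le_less_trans)
  have "Suc i \<le> j \<Longrightarrow> Max (supp (b i)) < Min (supp (b j))"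
    by (induction j rule: dec_induct) (auto intro: step block_seqD(4)[OF b])
  then show ?thesis using assms(2) by simp
qed

lemma block_seq_disjoint:
  assumes b: "block_seq b" and "i \<noteq> j" "k \<in> supp (b i)"
  shows "b j k = 0"
proof (rule ccontr)
  assume "b j k \<noteq> 0"
  then have k: "k \<in> supp (b j)" by (simp add: supp_def)
  have "Min (supp (b i)) \<le> k" "k \<le> Max (supp (b i))" "Min (supp (b j)) \<le> k" "k \<le> Max (supp (b j))"
    using k assms(3) block_seqD(1)[OF b] by simp_all
  then show False
    using block_seq_less[OF b, of i j] block_seq_less[OF b, of j i] assms(2) by linarith
qed

lemma block_seq_Min_ge: "block_seq b \<Longrightarrow> n \<le> Min (supp (b n))"
proof (induction n)
  case (Suc n)
  have "Min (supp (b n)) \<le> Max (supp (b n))"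
    using block_seqD(1,2)[OF Suc.prems] by (meson Max_ge Min_in)
  then show ?case using Suc block_seqD(4)[OF Suc.prems, of n] by simp
qed simp

lemma seq_span_base: "b n \<in> seq_span b"
  unfolding seq_span_def
  by (intro CollectI exI[of _ "Suc n"] exI[of _ "\<lambda>i. if i = n then 1 else 0"])
     (auto simp: fun_eq_iff if_distrib[of "\<lambda>x. x * _"] cong: if_cong)

lemma seq_span_zero: "(\<lambda>_. 0) \<in> seq_span b"
  unfolding seq_span_def by (intro CollectI exI[of _ 0]) simp

lemma seq_span_scale:
  assumes "v \<in> seq_span b" shows "(\<lambda>k. a * v k) \<in> seq_span b"
proof -
  obtain N c where "v = (\<lambda>k. \<Sum>i<N. c i * b i k)" using assms by (auto simp: seq_span_def)
  then have "(\<lambda>k. a * v k) = (\<lambda>k. \<Sum>i<N. (a * c i) * b i k)"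
    by (simp add: sum_distrib_left mult.assoc)
  then show ?thesis unfolding seq_span_def mem_Collect_eq
    by (intro exI[of _ N] exI[of _ "\<lambda>i. a * c i"])
qed

lemma seq_span_add:
  assumes "v \<in> seq_span b" "w \<in> seq_span b" shows "(\<lambda>k. v k + w k) \<in> seq_span b"
proof -
  obtain N c where v: "v = (\<lambda>k. \<Sum>i<N. c i * b i k)" using assms by (auto simp: seq_span_def)
  obtain M d where w: "w = (\<lambda>k. \<Sum>i<M. d i * b i k)" using assms by (auto simp: seq_span_def)
  have pad: "(\<Sum>i<L. c i * b i k) = (\<Sum>i<K. (if i < L then c i else 0) * b i k)" if "L \<le> K" for L K c k
    by (rule sum.mono_neutral_cong_left) (use that in auto)
  have "(\<lambda>k. v k + w k) = (\<lambda>k. \<Sum>i<max N M. ((if i < N then c i else 0) + (if i < M then d i else 0)) * b i k)"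
    by (simp add: v w pad[of N "max N M"] pad[of M "max N M"] distrib_right sum.distrib)
  then show ?thesis unfolding seq_span_def mem_Collect_eq
    by (intro exI[of _ "max N M"] exI[of _ "\<lambda>i. (if i < N then c i else 0) + (if i < M then d i else 0)"])
qed

lemma block_subspace_sum:
  assumes "block_subspace Y" "finite I" "\<And>i. i \<in> I \<Longrightarrow> w i \<in> Y"
  shows "(\<lambda>k. \<Sum>i\<in>I. c i * w i k) \<in> Y"
proof -
  obtain b where Y: "Y = seq_span b" using assms(1) by (auto simp: block_subspace_def)
  show ?thesis using assms(2,3) unfolding Y
    by (induction I rule: finite_induct) (auto intro!: seq_span_zero seq_span_add seq_span_scale)
qed

text \<open>On the support of \<open>b i\<close> all other block vectors vanish, so the value of
  \<open>v\<close> there isolates \<open>c i\<close>; it is zero because \<open>v\<close> starts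
  later.\<close>

lemma seq_span_tail:
  assumes b: "block_seq b" and v: "v \<in> seq_span b"
    and j: "\<And>i. i < j \<Longrightarrow> Max (supp (b i)) < Min (supp v)" and fin: "finite (supp v)"
  obtains N c where "v = (\<lambda>k. \<Sum>i\<in>{j..<N}. c i * b i k)"
proof -
  obtain N c where vc: "v = (\<lambda>k. \<Sum>i<N. c i * b i k)" using v by (auto simp: seq_span_def)
  have c0: "c i = 0" if i: "i < j" "i < N" for i
  proof -
    obtain k where k: "k \<in> supp (b i)" using block_seqD(2)[OF b] by blast
    have "v k = (\<Sum>l\<in>{i}. c l * b l k)"
      unfolding vc by (rule sum.mono_neutral_right) (use i block_seq_disjoint[OF b _ k] in auto)
    moreover have "k \<le> Max (supp (b i))" using k block_seqD(1)[OF b] by simp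
    then have "k \<notin> supp v" using j[OF i(1)] fin by (metis Min_le leD order.strict_trans1)
    ultimately show ?thesis using k by (simp add: supp_def)
  qed
  have "v = (\<lambda>k. \<Sum>i\<in>{j..<N}. c i * b i k)"
    unfolding vc by (rule ext, rule sum.mono_neutral_right) (use c0 in auto)
  then show thesis by (rule that)
qed

lemma block_subspace_Evec:
  assumes "block_subspace X" shows "X \<subseteq> Evec"
proof
  obtain b where b: "block_seq b" "X = seq_span b" using assms by (auto simp: block_subspace_def)
  fix v assume "v \<in> X"
  then obtain N c where v: "v = (\<lambda>k. \<Sum>i<N. c i * b i k)" using b by (auto simp: seq_span_def)
  have "supp v \<subseteq> (\<Union>i<N. supp (b i))"
  proof
    fix k assume "k \<in> supp v"
    then have "(\<Sum>i<N. c i * b i k) \<noteq> 0" by (simp add: v supp_def)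
    then obtain i where "i < N" "c i * b i k \<noteq> 0" by (metis (no_types, lifting) lessThan_iff sum.not_neutral_contains_not_neutral)
    then show "k \<in> (\<Union>i<N. supp (b i))" by (auto simp: supp_def)
  qed
  then show "v \<in> Evec" using block_seqD(1)[OF b(1)] by (auto simp: Evec_def intro: finite_subset)
qed

lemma block_subspace_tail_nonempty:
  assumes "block_subspace X" shows "\<exists>v. v \<in> tail_sub X m"
proof -
  obtain b where b: "block_seq b" "X = seq_span b" using assms by (auto simp: block_subspace_def)
  have "b (Suc m) \<in> tail_sub X m"
    using block_seq_Min_ge[OF b(1), of "Suc m"] block_seqD(3)[OF b(1)] seq_span_base[of b] b(2)
    by (simp add: tail_sub_def)
  then show ?thesis by blast
qed

lemma block_subspace_univ: "block_subspace (Evec :: 'f::field vec set)"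
proof -
  define e :: "nat \<Rightarrow> 'f vec" where "e = (\<lambda>n k. if k = n then 1 else 0)"
  have supp_e: "supp (e n) = {n}" for n by (auto simp: supp_def e_def)
  have "e n n \<noteq> 0" for n by (simp add: e_def)
  then have ne: "e n \<noteq> (\<lambda>_. 0)" for n by metis
  have b: "block_seq e"
    unfolding block_seq_def by (simp add: Evec_def supp_e ne)
  have "v \<in> seq_span e" if v: "v \<in> Evec" for v
  proof -
    have fin: "finite (supp v)" using v by (simp add: Evec_def)
    define N where "N = Suc (Max (insert 0 (supp v)))"
    have "v k = (\<Sum>i<N. v i * e i k)" for k
    proof (cases "k < N")
      case True
      then show ?thesis by (simp add: e_def if_distrib[of "\<lambda>x. _ * x"] cong: if_cong)
    next
      case False
      then have "k \<notin> insert 0 (supp v)"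
        using fin Max_ge[of "insert 0 (supp v)" k] unfolding N_def by (metis finite_insert less_Suc_eq_le)
      then show ?thesis using False by (auto simp: e_def supp_def intro!: sum.neutral)
    qed
    then show ?thesis by (auto simp: seq_span_def)
  qed
  moreover have "block_subspace (seq_span e)" using b by (auto simp: block_subspace_def)
  ultimately show ?thesis using block_subspace_Evec[of "seq_span e"]
    by (metis subset_antisym subsetI)
qed

section \<open>Diagonalization and generic subspaces\<close>

text \<open>Each \<open>b n\<close> is taken so far out in \<open>P n\<close> that it also lies in
  all earlier spaces. A vector of the span that starts after the first \<open>j\<close> block
  vectors is then a combination of vectors of \<open>P j\<close>.\<close>

lemma block_subspace_diagonal:
  assumes P: "\<And>n. block_subspace (P n)" "\<And>n. almost_sub (P (Suc n)) (P n)"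
  obtains X where "block_subspace X" "\<And>n. almost_sub X (P n)"
proof -
  have le: "almost_sub (P n) (P i)" if "i \<le> n" for i n
    using that
    by (induction n rule: dec_induct) (auto intro: almost_sub_subset almost_sub_trans P(2))
  have "\<exists>M. \<forall>i\<le>n. tail_sub (P n) M \<subseteq> P i" for n
  proof -
    obtain m where m: "\<And>i. i \<le> n \<Longrightarrow> tail_sub (P n) (m i) \<subseteq> P i"
      using le[of _ n] unfolding almost_sub_def by metis
    have "tail_sub (P n) (\<Sum>i\<le>n. m i) \<subseteq> P i" if i: "i \<le> n" for i
    proof -
      have "m i \<le> (\<Sum>i\<le>n. m i)" by (rule member_le_sum) (use i in auto)
      then show ?thesis using m[OF i] by (force simp: tail_sub_def)
    qed
    then show ?thesis by blast
  qed
  then obtain M where M: "\<And>n i. i \<le> n \<Longrightarrow> tail_sub (P n) (M n) \<subseteq> P i" by metis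
  have "\<exists>b. \<forall>n. b n \<in> tail_sub (P n) (M n) \<and> Max (supp (b n)) < Min (supp (b (Suc n)))"
  proof (rule dependent_nat_choice)
    show "\<exists>v. v \<in> tail_sub (P 0) (M 0)" by (rule block_subspace_tail_nonempty[OF P(1)])
    fix v n
    obtain w where "w \<in> tail_sub (P (Suc n)) (max (M (Suc n)) (Max (supp v)))"
      using block_subspace_tail_nonempty[OF P(1)] by blast
    then show "\<exists>w. w \<in> tail_sub (P (Suc n)) (M (Suc n)) \<and> Max (supp v) < Min (supp w)"
      by (intro exI[of _ w]) (auto simp: tail_sub_def)
  qed
  then obtain b where b: "\<And>n. b n \<in> tail_sub (P n) (M n)" "\<And>n. Max (supp (b n)) < Min (supp (b (Suc n)))"
    by blast
  have blk: "block_seq b"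
    using b block_subspace_Evec[OF P(1)] by (fastforce simp: block_seq_def tail_sub_def)
  have bP: "b n \<in> P i" if "i \<le> n" for i n using M[OF that] b(1) by blast
  have X: "block_subspace (seq_span b)" using blk by (auto simp: block_subspace_def)
  have "almost_sub (seq_span b) (P j)" for j
  proof -
    \<comment> \<open>The sum dominates the last coordinate of each of the first \<open>j\<close>
      block vectors.\<close>
    have "v \<in> P j" if v: "v \<in> tail_sub (seq_span b) (\<Sum>i<j. Max (supp (b i)))" for v
    proof -
      have "Max (supp (b i)) < Min (supp v)" if i: "i < j" for i
      proof -
        have "Max (supp (b i)) \<le> (\<Sum>i<j. Max (supp (b i)))"
          by (rule member_le_sum[where f = "\<lambda>i. Max (supp (b i))"]) (use i in auto)
        then show ?thesis using v by (simp add: tail_sub_def)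
      qed
      moreover have "v \<in> seq_span b" using v by (simp add: tail_sub_def)
      moreover have "finite (supp v)"
        using calculation(2) block_subspace_Evec[OF X] by (auto simp: Evec_def)
      ultimately obtain N c where "v = (\<lambda>k. \<Sum>i\<in>{j..<N}. c i * b i k)"
        using seq_span_tail[OF blk] by blast
      then show ?thesis using block_subspace_sum[OF P(1), of "{j..<N}" b j c] bP by simp
    qed
    then show ?thesis unfolding almost_sub_def by blast
  qed
  then show thesis using X that by blast
qed

text \<open>A Rasiowa-Sikorski argument for almost containment. That order admits lower bounds of
  descending sequences, so the bound itself, rather than only a filter, meets all
  requirements.\<close>

lemma block_subspace_generic:
  assumes P: "block_subspace P" and I: "countable I"
    and dense: "\<And>i p. i \<in> I \<Longrightarrow> block_subspace p \<Longrightarrow> \<exists>p'. block_subspace p' \<and> almost_sub p' p \<and> D i p'"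
    and down: "\<And>i p p'. D i p \<Longrightarrow> almost_sub p' p \<Longrightarrow> D i p'"
  obtains P' where "block_subspace P'" "almost_sub P' P" "\<And>i. i \<in> I \<Longrightarrow> D i P'"
proof (cases "I = {}")
  case True
  then show ?thesis using that[OF P] by (simp add: almost_sub_subset)
next
  case False
  have "\<exists>p. \<forall>n::nat. (block_subspace (p n) \<and> (n = 0 \<longrightarrow> p n = P)) \<and>
      almost_sub (p (Suc n)) (p n) \<and> D (from_nat_into I n) (p (Suc n))"
  proof (rule dependent_nat_choice)
    fix p :: "'a vec set" and n :: nat assume "block_subspace p \<and> (n = 0 \<longrightarrow> p = P)"
    then obtain p' where "block_subspace p'" "almost_sub p' p" "D (from_nat_into I n) p'"
      using dense[OF from_nat_into[OF False]] by blast
    then show "\<exists>p'. (block_subspace p' \<and> (Suc n = 0 \<longrightarrow> p' = P)) \<and> almost_sub p' p \<and> D (from_nat_into I n) p'"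
      by auto
  qed (use P in auto)
  then obtain p where p: "\<And>n. block_subspace (p n)" "p 0 = P" "\<And>n. almost_sub (p (Suc n)) (p n)"
      "\<And>n. D (from_nat_into I n) (p (Suc n))"
    by blast
  obtain X where X: "block_subspace X" "\<And>n. almost_sub X (p n)"
    using block_subspace_diagonal[of p, OF p(1,3)] by blast
  show ?thesis
  proof (rule that[OF X(1)])
    show "almost_sub X P" using X(2)[of 0] p(2) by simp
    fix i assume "i \<in> I"
    then obtain n where "i = from_nat_into I n" using from_nat_into_surj[OF I] by metis
    then show "D i X" using down[OF p(4)[of n] X(2)] by simp
  qed
qed

text \<open>The countability of the field enters here: a vector is the zero extension of a finite
  list.\<close>

lemma countable_Evec: "countable (Evec :: 'f::{zero,countable} vec set)"
proof -
  have "Evec \<subseteq> (\<lambda>xs k. if k < length xs then xs ! k else 0) ` (UNIV :: 'f list set)"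
  proof
    fix v :: "'f vec" assume "v \<in> Evec"
    then have fin: "finite (supp v)" by (simp add: Evec_def)
    define N where "N = Suc (Max (insert 0 (supp v)))"
    have "v k = 0" if "\<not> k < N" for k
    proof (rule ccontr)
      assume "v k \<noteq> 0"
      then have "k \<in> insert 0 (supp v)" by (simp add: supp_def)
      then show False using that fin Max_ge[of "insert 0 (supp v)" k]
        unfolding N_def by (metis finite_insert less_Suc_eq_le)
    qed
    then have "v = (\<lambda>k. if k < length (map v [0..<N]) then map v [0..<N] ! k else 0)"
      by (auto simp: fun_eq_iff)
    then show "v \<in> (\<lambda>xs k. if k < length xs then xs ! k else 0) ` UNIV" by blast
  qed
  then show ?thesis by (rule countable_subset) simp
qed

section \<open>Fusion of strategies in the Kastanas game\<close>

type_synonym 'f move = "'f vec \<times> 'f vec set"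

text \<open>The whole space at the empty position makes the opening move obey the same rule as the
  later ones.\<close>

definition last_space :: "'f::zero move list \<Rightarrow> 'f vec set" where
  "last_space r = (if r = [] then Evec else snd (last r))"

text \<open>In Kastanas' game each player picks a vector from the opponent's last subspace and a new
  subspace almost contained in it. Requiring almost containment only makes \<open>legal\<close> insensitive to
  tails, so that one \<open>X\<close> obtained by diagonalization fits all positions of the fusion. The
  vector of the very first move is a dummy: the outcome of a run \<open>f\<close> is \<open>\<lambda>m. fst (f (Suc m))\<close>.\<close>

definition legal :: "'f::field move list \<Rightarrow> 'f move \<Rightarrow> bool" where
  "legal r m \<longleftrightarrow> fst m \<in> last_space r \<and> fst m \<noteq> (\<lambda>_. 0) \<and>
     block_subspace (snd m) \<and> almost_sub (snd m) (last_space r)"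

definition kastanas :: "'f::field move list set" where
  "kastanas = {r. \<forall>i<length r. legal (take i r) (r ! i)}"

lemma last_space_snoc [simp]: "last_space (r @ [m]) = snd m"
  by (simp add: last_space_def)

lemma kastanas_Nil: "[] \<in> kastanas"
  by (simp add: kastanas_def)

lemma kastanas_snoc: "r @ [m] \<in> kastanas \<longleftrightarrow> r \<in> kastanas \<and> legal r m"
  by (auto simp: kastanas_def less_Suc_eq nth_append)

lemma kastanas_last_space: "r \<in> kastanas \<Longrightarrow> block_subspace (last_space r)"
  by (cases r rule: rev_cases) (auto simp: kastanas_snoc legal_def last_space_def block_subspace_univ)

lemma pruned_kastanas: "pruned (kastanas :: 'f::field move list set)"
  unfolding pruned_def
proof
  fix r :: "'f move list" assume r: "r \<in> kastanas"
  obtain v where "v \<in> tail_sub (last_space r) 0"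
    using block_subspace_tail_nonempty[OF kastanas_last_space[OF r]] by blast
  then have "legal r (v, last_space r)"
    using kastanas_last_space[OF r] by (simp add: legal_def tail_sub_def almost_sub_subset)
  then show "\<exists>m. r @ [m] \<in> kastanas" using r kastanas_snoc by blast
qed

lemma kastanas_snoc2:
  assumes "r @ [(v, Z), (v', W)] \<in> kastanas"
  shows "v \<in> Evec" "v' \<in> Evec" "v' \<in> Z" "v' \<noteq> (\<lambda>_. 0)" "block_subspace W" "almost_sub W Z"
proof -
  have *: "(r @ [(v, Z)]) @ [(v', W)] \<in> kastanas" using assms by simp
  then have l: "legal r (v, Z)" "legal (r @ [(v, Z)]) (v', W)" "r \<in> kastanas"
    unfolding kastanas_snoc by auto
  then show "v' \<in> Z" "v' \<noteq> (\<lambda>_. 0)" "block_subspace W" "almost_sub W Z" "v \<in> Evec" "v' \<in> Evec"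
    using block_subspace_Evec[of Z] block_subspace_Evec[OF kastanas_last_space[OF l(3)]]
    by (auto simp: legal_def)
qed

text \<open>For each position in \<open>C\<close> and each pair \<open>v\<close>, \<open>v'\<close>, either some round with these vectors is
  already witnessed in \<open>C'\<close>, or no subspace almost contained in \<open>P'\<close> allows one. Only the vectors
  are quantified over, which keeps the number of requirements countable.\<close>

lemma fusion_level:
  fixes S :: "'f::{field,countable} move list set"
  assumes S: "S \<subseteq> kastanas" and C: "countable C" and P: "block_subspace P"
  obtains C' P' where "countable C'" "block_subspace P'" "almost_sub P' P"
    "\<And>q. q \<in> C' \<Longrightarrow> \<exists>r\<in>C. \<exists>m m'. q = r @ [m, m']" "C' \<subseteq> S"
    "\<And>q. q \<in> C' \<Longrightarrow> almost_sub P' (last_space q)"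
    "\<And>r v v' Z W. r \<in> C \<Longrightarrow> almost_sub Z P' \<Longrightarrow> r @ [(v, Z), (v', W)] \<in> S \<Longrightarrow>
        \<exists>Z' W'. r @ [(v, Z'), (v', W')] \<in> C'"
proof -
  define I :: "('f move list \<times> 'f vec \<times> 'f vec) set" where "I = C \<times> Evec \<times> Evec"
  define pos where "pos = (\<lambda>(r, v, v') p. \<exists>Z W. r @ [(v, Z), (v', W)] \<in> S \<and> almost_sub p W)"
  define neg where "neg = (\<lambda>(r :: 'f move list, v, v') p. \<forall>Z W. almost_sub Z p \<longrightarrow> r @ [(v, Z), (v', W)] \<notin> S)"
  have "countable I" unfolding I_def using C countable_Evec by blast
  then have "\<exists>P'. block_subspace P' \<and> almost_sub P' P \<and> (\<forall>i\<in>I. pos i P' \<or> neg i P')"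
  proof (rule block_subspace_generic[OF P, where D = "\<lambda>i p. pos i p \<or> neg i p"])
    fix i and p :: "'f vec set" assume "block_subspace p"
    show "\<exists>p'. block_subspace p' \<and> almost_sub p' p \<and> (pos i p' \<or> neg i p')"
    proof (cases "neg i p")
      case True
      then show ?thesis using \<open>block_subspace p\<close> almost_sub_subset by blast
    next
      case False
      obtain r v v' where i: "i = (r, v, v')" by (cases i)
      \<comment> \<open>A failure of \<open>neg\<close> supplies a round whose final subspace
        \<open>W\<close> is almost contained in \<open>p\<close>; shrinking \<open>p\<close> to
        \<open>W\<close> makes \<open>pos\<close> true.\<close>
      obtain Z W where Z: "almost_sub Z p" "r @ [(v, Z), (v', W)] \<in> S"
        using False by (auto simp: neg_def i)
      then have "block_subspace W" "almost_sub W Z" using kastanas_snoc2(5,6)[of r v Z v' W] S by auto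
      moreover have "pos i W" using Z almost_sub_subset[of W W] by (auto simp: pos_def i)
      ultimately show ?thesis using Z almost_sub_trans by blast
    qed
  next
    fix i and p p' :: "'f vec set" assume i: "pos i p \<or> neg i p" and p: "almost_sub p' p"
    obtain r v v' where "i = (r, v, v')" by (cases i)
    then show "pos i p' \<or> neg i p'"
      using i almost_sub_trans[OF p] almost_sub_trans[OF _ p] unfolding pos_def neg_def by auto
  qed blast
  then obtain P' where P': "block_subspace P'" "almost_sub P' P"
    "\<And>i. i \<in> I \<Longrightarrow> pos i P' \<or> neg i P'" by blast
  \<comment> \<open>Choosing one witness per triple keeps \<open>C'\<close> countable, whatever the
    number of subspaces.\<close>
  define wit where "wit = (\<lambda>(r, v, v'). SOME q. q \<in> S \<and> (\<exists>Z W. q = r @ [(v, Z), (v', W)] \<and> almost_sub P' W))"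
  have wit: "wit (r, v, v') \<in> S \<and> (\<exists>Z W. wit (r, v, v') = r @ [(v, Z), (v', W)] \<and> almost_sub P' W)"
    if "pos (r, v, v') P'" for r v v'
    unfolding wit_def prod.case by (rule someI_ex) (use that in \<open>auto simp: pos_def\<close>)
  define C' where "C' = wit ` {i \<in> I. pos i P'}"
  show thesis
  proof (rule that[OF _ P'(1,2)])
    show "countable C'" using \<open>countable I\<close> by (simp add: C'_def)
    show "C' \<subseteq> S" using wit by (auto simp: C'_def)
    show "\<exists>r\<in>C. \<exists>m m'. q = r @ [m, m']" "almost_sub P' (last_space q)" if "q \<in> C'" for q
      using that wit by (fastforce simp: C'_def I_def last_space_def)+
    fix r v v' Z W assume *: "r \<in> C" "almost_sub Z P'" "r @ [(v, Z), (v', W)] \<in> S"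
    then have "(r, v, v') \<in> I" using kastanas_snoc2(1,2)[of r v Z v' W] S by (auto simp: I_def)
    moreover have "\<not> neg (r, v, v') P'" using * by (auto simp: neg_def)
    ultimately have "pos (r, v, v') P'" "wit (r, v, v') \<in> C'" using P'(3) by (auto simp: C'_def)
    then show "\<exists>Z' W'. r @ [(v, Z'), (v', W')] \<in> C'" using wit by metis
  qed
qed

text \<open>The levels are iterated and \<open>X\<close> is a diagonal of the spaces
  \<open>P n\<close>. What is almost contained in \<open>X\<close> is almost contained in
  \<open>P (Suc n)\<close>, so rounds after a position of level \<open>n\<close> are matched at
  level \<open>n + 1\<close>.\<close>

lemma fusion:
  fixes S :: "'f::{field,countable} move list set"
  assumes S: "S \<subseteq> kastanas" and alt: "\<And>r m. s (r @ [m]) \<longleftrightarrow> \<not> s r" and r0: "r0 \<in> S" "\<not> s r0"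
  obtains X C where "block_subspace X" "r0 \<in> C" "C \<subseteq> S" "\<And>r. r \<in> C \<Longrightarrow> \<not> s r"
    "\<And>r. r \<in> C \<Longrightarrow> almost_sub X (last_space r)"
    "\<And>r v v' Z W. r \<in> C \<Longrightarrow> almost_sub Z X \<Longrightarrow> r @ [(v, Z), (v', W)] \<in> S \<Longrightarrow>
        \<exists>Z' W'. r @ [(v, Z'), (v', W')] \<in> C"
proof -
  define ok where "ok = (\<lambda>(C, P). countable C \<and> C \<subseteq> S \<and> block_subspace P \<and>
      (\<forall>r\<in>C. \<not> s r \<and> almost_sub P (last_space r)))"
  define stp where "stp = (\<lambda>(C, P) (C', P'). almost_sub P' P \<and>
      (\<forall>r v v' Z W. r \<in> C \<longrightarrow> almost_sub Z P' \<longrightarrow> r @ [(v, Z), (v', W)] \<in> S \<longrightarrow>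
        (\<exists>Z' W'. r @ [(v, Z'), (v', W')] \<in> C')))"
  have "\<exists>h. \<forall>n::nat. (ok (h n) \<and> (n = 0 \<longrightarrow> r0 \<in> fst (h n))) \<and> stp (h n) (h (Suc n))"
  proof (rule dependent_nat_choice)
    have "block_subspace (last_space r0)" using kastanas_last_space r0(1) S by blast
    then show "\<exists>x. ok x \<and> ((0::nat) = 0 \<longrightarrow> r0 \<in> fst x)"
      using r0 by (intro exI[of _ "({r0}, last_space r0)"]) (simp add: ok_def almost_sub_subset)
  next
    fix x :: "'f move list set \<times> 'f vec set" and n :: nat
    assume "ok x \<and> (n = 0 \<longrightarrow> r0 \<in> fst x)"
    moreover obtain C P where x: "x = (C, P)" by (cases x)
    ultimately have C: "countable C" "block_subspace P" "\<And>r. r \<in> C \<Longrightarrow> \<not> s r" by (auto simp: ok_def)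
    obtain C' P' where C': "countable C'" "block_subspace P'" "almost_sub P' P"
      "\<And>q. q \<in> C' \<Longrightarrow> \<exists>r\<in>C. \<exists>m m'. q = r @ [m, m']" "C' \<subseteq> S"
      "\<And>q. q \<in> C' \<Longrightarrow> almost_sub P' (last_space q)"
      "\<And>r v v' Z W. r \<in> C \<Longrightarrow> almost_sub Z P' \<Longrightarrow> r @ [(v, Z), (v', W)] \<in> S \<Longrightarrow>
        \<exists>Z' W'. r @ [(v, Z'), (v', W')] \<in> C'"
      by (rule fusion_level[OF S C(1,2)]) blast
    have "\<not> s q" if "q \<in> C'" for q
      using C'(4)[OF that] C(3) alt[of "_ @ [_]"] alt by (metis append.assoc append_Cons append_Nil)
    then have "ok (C', P')" using C' by (simp add: ok_def)
    moreover have "stp x (C', P')" using C'(3,7) unfolding stp_def x by blast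
    ultimately show "\<exists>y. (ok y \<and> (Suc n = 0 \<longrightarrow> r0 \<in> fst y)) \<and> stp x y" by blast
  qed
  then obtain h where h: "\<And>n. ok (h n)" "r0 \<in> fst (h 0)" "\<And>n. stp (h n) (h (Suc n))" by blast
  define C P where "C = (\<lambda>n. fst (h n))" and "P = (\<lambda>n. snd (h n))"
  have hn: "h n = (C n, P n)" for n by (simp add: C_def P_def)
  have P: "block_subspace (P n)" "almost_sub (P (Suc n)) (P n)" for n
    using h(1)[of n] h(3)[of n] by (simp_all add: hn ok_def stp_def)
  obtain X where X: "block_subspace X" "\<And>n. almost_sub X (P n)"
    using block_subspace_diagonal[of P, OF P] by blast
  show thesis
  proof (rule that[OF X(1), of "\<Union>n. C n"])
    show "r0 \<in> (\<Union>n. C n)" using h(2) by (auto simp: C_def)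
    show "(\<Union>n. C n) \<subseteq> S" using h(1) by (auto simp: hn ok_def)
    show "\<not> s r" "almost_sub X (last_space r)" if r: "r \<in> (\<Union>n. C n)" for r
    proof -
      obtain n where "r \<in> C n" using r by blast
      then have "\<not> s r" "almost_sub (P n) (last_space r)" using h(1)[of n] by (auto simp: hn ok_def)
      then show "\<not> s r" "almost_sub X (last_space r)" using almost_sub_trans[OF X(2)[of n]] by auto
    qed
    fix r v v' Z W assume *: "r \<in> (\<Union>n. C n)" "almost_sub Z X" "r @ [(v, Z), (v', W)] \<in> S"
    then obtain n where n: "r \<in> C n" by blast
    have "almost_sub Z (P (Suc n))" using almost_sub_trans[OF *(2) X(2)] .
    moreover have "stp (C n, P n) (C (Suc n), P (Suc n))" using h(3)[of n] by (simp add: hn)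
    ultimately have "\<exists>Z' W'. r @ [(v, Z'), (v', W')] \<in> C (Suc n)"
      using n *(3) unfolding stp_def prod.case by blast
    then show "\<exists>Z' W'. r @ [(v, Z'), (v', W')] \<in> (\<Union>n. C n)" by blast
  qed
qed

text \<open>The recorded position \<open>foldl nxt r0 h\<close> shadows the real run: same vectors,
  possibly other subspaces. A vector far out in \<open>X\<close> lies in the last recorded subspace,
  and \<open>Z \<subseteq> X\<close> is almost contained in it, so the real move is legal at the
  shadow position. The strategy \<open>S\<close> answers it, and the fusion records a round with the
  same two vectors.\<close>

lemma fusion_strategy:
  fixes S :: "'f::{field,countable} move list set"
  assumes strat: "strat s kastanas S" and closed: "\<And>q n. q \<in> S \<Longrightarrow> take n q \<in> S"
    and alt: "\<And>r m. s (r @ [m]) \<longleftrightarrow> \<not> s r" and r0: "r0 \<in> S" "\<not> s r0"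
  obtains X and resp :: "'f move list \<Rightarrow> 'f vec \<times> nat"
  where "block_subspace X" "tail_sub X (snd (resp [])) \<subseteq> last_space r0"
    "\<And>v Z. let mv = (\<lambda>k. resp (map (\<lambda>i. (v i, Z i)) [0..<k])) in
      (\<forall>k. block_subspace (Z k) \<and> Z k \<subseteq> X) \<longrightarrow> v 0 \<in> last_space r0 \<longrightarrow> v 0 \<noteq> (\<lambda>_. 0) \<longrightarrow>
      (\<forall>k. v (Suc k) \<in> tail_sub X (snd (mv (Suc k)))) \<longrightarrow>
      (\<forall>k. fst (mv (Suc k)) \<in> Z k \<and> fst (mv (Suc k)) \<noteq> (\<lambda>_. 0)) \<and>
      (\<exists>f\<in>branches S []. pre f (length r0) = r0 \<and>
        (\<forall>k. fst (f (length r0 + 2 * k)) = v k \<and> fst (f (Suc (length r0 + 2 * k))) = fst (mv (Suc k))))"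
proof -
  have S: "S \<subseteq> kastanas" using strat_subset[OF strat] .
  obtain X C where X: "block_subspace X" "r0 \<in> C" "C \<subseteq> S" "\<And>r. r \<in> C \<Longrightarrow> \<not> s r"
    "\<And>r. r \<in> C \<Longrightarrow> almost_sub X (last_space r)"
    "\<And>r v v' Z W. r \<in> C \<Longrightarrow> almost_sub Z X \<Longrightarrow> r @ [(v, Z), (v', W)] \<in> S \<Longrightarrow>
        \<exists>Z' W'. r @ [(v, Z'), (v', W')] \<in> C"
    by (rule fusion[of S s r0, OF S alt r0]) blast
  define good where "good = (\<lambda>r (v, Z) q. q \<in> C \<and> (\<exists>Z' v' W'. q = r @ [(v, Z'), (v', W')] \<and> v' \<in> Z \<and> v' \<noteq> (\<lambda>_. 0)))"
  define nxt where "nxt = (\<lambda>r m. SOME q. good r m q)"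
  define bound where "bound = (\<lambda>r. SOME n. tail_sub X n \<subseteq> last_space r)"
  \<comment> \<open>The number tells where the opponent's next vector has to start; for the empty
    history it becomes \<open>n0\<close> of the game \<open>A\<^sub>X\<close>.\<close>
  define resp where "resp = (\<lambda>h. let r = foldl nxt r0 h in (fst (last r), bound r))"
  have bound: "tail_sub X (bound r) \<subseteq> last_space r" if "r \<in> C" for r
    unfolding bound_def using X(5)[OF that] unfolding almost_sub_def by (rule someI_ex)
  have nxt: "good r (v, Z) (nxt r (v, Z))"
    if r: "r \<in> C" and v: "v \<in> last_space r" "v \<noteq> (\<lambda>_. 0)" and Z: "block_subspace Z" "Z \<subseteq> X" for r v Z
  proof -
    have ZX: "almost_sub Z X" using Z(2) by (rule almost_sub_subset)
    have "legal r (v, Z)"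
      using v Z almost_sub_trans[OF ZX X(5)[OF r]] by (simp add: legal_def)
    moreover have rS: "r \<in> S" "\<not> s r" using r X by auto
    ultimately have "r @ [(v, Z)] \<in> S"
      using strat_opp[OF strat] S kastanas_snoc by blast
    moreover have "s (r @ [(v, Z)])" using alt rS by simp
    ultimately obtain m where m: "(r @ [(v, Z)]) @ [m] \<in> S" using strat_own[OF strat] by blast
    obtain v' W where "m = (v', W)" by (cases m)
    with m have m: "r @ [(v, Z), (v', W)] \<in> S" by simp
    \<comment> \<open>The recorded \<open>Z'\<close> may differ from \<open>Z\<close>. That
      \<open>v'\<close> lies in \<open>Z\<close> follows from the legality of the round in
      \<open>m\<close>, which was played after \<open>Z\<close> itself.\<close>
    obtain Z' W' where "r @ [(v, Z'), (v', W')] \<in> C" using X(6)[OF r ZX m] by blast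
    then have "good r (v, Z) (r @ [(v, Z'), (v', W')])"
      using kastanas_snoc2[of r v Z v' W] m S by (auto simp: good_def)
    then show ?thesis unfolding nxt_def by (rule someI)
  qed
  show thesis
  proof (rule that[OF X(1), of resp])
    show "tail_sub X (snd (resp [])) \<subseteq> last_space r0" using bound[OF X(2)] by (simp add: resp_def)
    fix v Z
    define R where "R = (\<lambda>k. foldl nxt r0 (map (\<lambda>i. (v i, Z i)) [0..<k]))"
    define mv where "mv = (\<lambda>k. resp (map (\<lambda>i. (v i, Z i)) [0..<k]))"
    have R_Suc: "R (Suc k) = nxt (R k) (v k, Z k)" for k by (simp add: R_def)
    have mv: "mv k = (fst (last (R k)), bound (R k))" for k by (simp add: mv_def resp_def R_def Let_def)
    have "(\<forall>k. fst (mv (Suc k)) \<in> Z k \<and> fst (mv (Suc k)) \<noteq> (\<lambda>_. 0)) \<and>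
      (\<exists>f\<in>branches S []. pre f (length r0) = r0 \<and>
        (\<forall>k. fst (f (length r0 + 2 * k)) = v k \<and> fst (f (Suc (length r0 + 2 * k))) = fst (mv (Suc k))))"
      if Z: "\<And>k. block_subspace (Z k) \<and> Z k \<subseteq> X" and v0: "v 0 \<in> last_space r0" "v 0 \<noteq> (\<lambda>_. 0)"
        and vS: "\<And>k. v (Suc k) \<in> tail_sub X (snd (mv (Suc k)))"
    proof -
      have vk: "v k \<in> last_space (R k) \<and> v k \<noteq> (\<lambda>_. 0)" if "R k \<in> C" for k
      proof (cases k)
        case 0
        then show ?thesis using v0 by (simp add: R_def)
      next
        case (Suc j)
        then have "v k \<in> tail_sub X (bound (R k))" using vS[of j] by (simp add: mv)
        then show ?thesis using bound[OF that] by (auto simp: tail_sub_def)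
      qed
      have RC: "R k \<in> C" for k
      proof (induction k)
        case 0
        show ?case using X(2) by (simp add: R_def)
      next
        case (Suc k)
        then show ?case using nxt[OF Suc, of "v k" "Z k"] vk[OF Suc] Z[of k] by (simp add: R_Suc good_def)
      qed
      have step: "\<exists>Z' W'. R (Suc k) = R k @ [(v k, Z'), (fst (mv (Suc k)), W')]"
        and own: "fst (mv (Suc k)) \<in> Z k \<and> fst (mv (Suc k)) \<noteq> (\<lambda>_. 0)" for k
        using nxt[OF RC, of "v k" k "Z k"] vk[OF RC, of k] Z[of k] unfolding mv R_Suc
        by (auto simp: good_def)
      have len: "length (R k) = length r0 + 2 * k" for k
      proof (induction k)
        case (Suc k)
        obtain Z' W' where "R (Suc k) = R k @ [(v k, Z'), (fst (mv (Suc k)), W')]" using step by blast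
        then show ?case using Suc by simp
      qed (simp add: R_def)
      have tk: "take (length (R k)) (R k') = R k" if "k \<le> k'" for k k'
        using that
      proof (induction k' rule: dec_induct)
        case (step k')
        obtain Z' W' where "R (Suc k') = R k' @ [(v k', Z'), (fst (mv (Suc k')), W')]"
          using \<open>\<And>k. \<exists>Z' W'. R (Suc k) = R k @ [(v k, Z'), (fst (mv (Suc k)), W')]\<close> by blast
        then show ?case using step len by simp
      qed simp
      \<comment> \<open>The nested shadow positions have a limit; \<open>R (Suc n)\<close> is
        already longer than \<open>n\<close>.\<close>
      define f where "f = (\<lambda>n. R (Suc n) ! n)"
      have f: "f n = R k ! n" if "n < length (R k)" for n k
      proof (cases "k \<le> Suc n")
        case True
        then show ?thesis using tk[OF True] that unfolding f_def by (metis nth_take)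
      next
        case False
        then have "take (length (R (Suc n))) (R k) = R (Suc n)" using tk by simp
        moreover have "n < length (R (Suc n))" by (simp add: len)
        ultimately show ?thesis unfolding f_def by (metis nth_take)
      qed
      have preR: "pre f (length (R k)) = R k" for k
        by (rule nth_equalityI) (auto simp: pre_def f)
      have "pre f n \<in> S" for n
      proof -
        have "n \<le> length (R n)" by (simp add: len)
        then have "pre f n = take n (R n)" using preR[of n] by (metis take_pre)
        then show ?thesis using closed RC X(3) by auto
      qed
      then have "f \<in> branches S []" by (simp add: branches_def)
      moreover have "pre f (length r0) = r0" using preR[of 0] by (simp add: R_def)
      moreover have "fst (f (length r0 + 2 * k)) = v k \<and> fst (f (Suc (length r0 + 2 * k))) = fst (mv (Suc k))" for k
      proof -
        obtain Z' W' where W': "R (Suc k) = R k @ [(v k, Z'), (fst (mv (Suc k)), W')]" using step by blast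
        have "f (length (R k)) = R (Suc k) ! length (R k)" "f (Suc (length (R k))) = R (Suc k) ! Suc (length (R k))"
          by (rule f; simp add: len)+
        then show ?thesis unfolding W' len[symmetric] by (simp add: nth_append)
      qed
      ultimately show ?thesis using own by blast
    qed
    then show "let mv = (\<lambda>k. resp (map (\<lambda>i. (v i, Z i)) [0..<k])) in
      (\<forall>k. block_subspace (Z k) \<and> Z k \<subseteq> X) \<longrightarrow> v 0 \<in> last_space r0 \<longrightarrow> v 0 \<noteq> (\<lambda>_. 0) \<longrightarrow>
      (\<forall>k. v (Suc k) \<in> tail_sub X (snd (mv (Suc k)))) \<longrightarrow>
      (\<forall>k. fst (mv (Suc k)) \<in> Z k \<and> fst (mv (Suc k)) \<noteq> (\<lambda>_. 0)) \<and>
      (\<exists>f\<in>branches S []. pre f (length r0) = r0 \<and>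
        (\<forall>k. fst (f (length r0 + 2 * k)) = v k \<and> fst (f (Suc (length r0 + 2 * k))) = fst (mv (Suc k))))"
      unfolding Let_def mv_def[symmetric] by blast
  qed
qed

section \<open>The adversarial Gowers games\<close>

lemma kastanas_branch_Einf:
  assumes "f \<in> branches kastanas []"
  shows "(\<lambda>m. fst (f (Suc m))) \<in> Einf"
proof -
  have "fst (f n) \<in> Evec" for n
  proof -
    have "pre f n @ [f n] \<in> kastanas"
      using assms by (simp add: branches_def pre_Suc[symmetric])
    then have "pre f n \<in> kastanas" "legal (pre f n) (f n)" by (simp_all add: kastanas_snoc)
    then show ?thesis using block_subspace_Evec[OF kastanas_last_space] by (auto simp: legal_def)
  qed
  then show ?thesis by (simp add: Einf_def)
qed

lemma wins_kastanas_closedE: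
  fixes s :: "'f::field move list \<Rightarrow> bool"
  assumes "wins s kastanas [] W"
  obtains S where "strat s kastanas S" "[] \<in> S" "\<And>q n. q \<in> S \<Longrightarrow> take n q \<in> S"
    "branches S [] \<subseteq> W \<inter> branches kastanas []"
proof -
  obtain S where S: "strat s kastanas S" "[] \<in> S" "branches S [] \<subseteq> W"
    "\<forall>q\<in>S. length ([] :: 'f move list) \<le> length q \<and> take (length ([] :: 'f move list)) q = []"
    "\<forall>q\<in>S. \<forall>n\<ge>length ([] :: 'f move list). take n q \<in> S"
    using assms by (rule wins_closedE)
  have "branches S [] \<subseteq> branches kastanas []"
    using strat_subset[OF S(1)] by (auto simp: branches_def)
  then show thesis using S by (intro that[of S]) auto
qed

text \<open>II owns the even lengths. His opening move \<open>m\<close> supplies the dummy vector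
  and a subspace for the first vector of I, so the fusion starts at \<open>[m]\<close>. In the
  shadow run, \<open>x k\<close> and \<open>y k\<close> are the vectors at places
  \<open>2 * k + 1\<close> and \<open>2 * k + 2\<close>.\<close>

lemma II_wins_A_if_wins_kastanas:
  fixes B :: "(nat \<Rightarrow> 'f::{field,countable} vec) set"
  assumes w: "wins (\<lambda>r. even (length r)) kastanas [] W"
    and W: "\<And>f. f \<in> W \<Longrightarrow> f \<in> branches kastanas [] \<Longrightarrow> (\<lambda>m. fst (f (Suc m))) \<in> B"
  shows "\<exists>X. block_subspace X \<and> II_wins_A X B"
proof -
  let ?s = "\<lambda>r :: 'f move list. even (length r)"
  obtain S where S: "strat ?s kastanas S" "[] \<in> S" "\<And>q n. q \<in> S \<Longrightarrow> take n q \<in> S"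
    "branches S [] \<subseteq> W \<inter> branches kastanas []"
    using wins_kastanas_closedE[OF w] by blast
  obtain m where m: "[m] \<in> S" using strat_own[OF S(1,2)] by auto
  obtain X and resp :: "'f move list \<Rightarrow> 'f vec \<times> nat" where X: "block_subspace X"
    and n0: "tail_sub X (snd (resp [])) \<subseteq> last_space [m]"
    and resp: "\<And>v Z. let mv = (\<lambda>k. resp (map (\<lambda>i. (v i, Z i)) [0..<k])) in
      (\<forall>k. block_subspace (Z k) \<and> Z k \<subseteq> X) \<longrightarrow> v 0 \<in> last_space [m] \<longrightarrow> v 0 \<noteq> (\<lambda>_. 0) \<longrightarrow>
      (\<forall>k. v (Suc k) \<in> tail_sub X (snd (mv (Suc k)))) \<longrightarrow>
      (\<forall>k. fst (mv (Suc k)) \<in> Z k \<and> fst (mv (Suc k)) \<noteq> (\<lambda>_. 0)) \<and>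
      (\<exists>f\<in>branches S []. pre f (length [m]) = [m] \<and>
        (\<forall>k. fst (f (length [m] + 2 * k)) = v k \<and> fst (f (Suc (length [m] + 2 * k))) = fst (mv (Suc k))))"
    by (rule fusion_strategy[OF S(1,3), where ?r0.0 = "[m]"]) (use m in auto)
  have "II_wins_A X B"
    unfolding II_wins_A_def Let_def
  proof (intro exI[of _ "snd (resp [])"] exI[of _ resp] allI impI)
    fix x :: "nat \<Rightarrow> 'f vec" and Z
    define mv where "mv = (\<lambda>k. resp (map (\<lambda>i. (x i, Z i)) [0..<k]))"
    assume "\<forall>k. x k \<in> tail_sub X (if k = 0 then snd (resp []) else snd (resp (map (\<lambda>i. (x i, Z i)) [0..<k]))) \<and>
        block_subspace (Z k) \<and> Z k \<subseteq> X"
    then have run: "\<And>k. x k \<in> tail_sub X (if k = 0 then snd (resp []) else snd (mv k))"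
      "\<And>k. block_subspace (Z k) \<and> Z k \<subseteq> X"
      unfolding mv_def by blast+
    have "x 0 \<in> last_space [m]" "x 0 \<noteq> (\<lambda>_. 0)" using run(1)[of 0] n0 by (auto simp: tail_sub_def)
    moreover have "x (Suc k) \<in> tail_sub X (snd (mv (Suc k)))" for k using run(1)[of "Suc k"] by simp
    ultimately have *: "(\<forall>k. fst (mv (Suc k)) \<in> Z k \<and> fst (mv (Suc k)) \<noteq> (\<lambda>_. 0)) \<and>
      (\<exists>f\<in>branches S []. pre f (length [m]) = [m] \<and>
        (\<forall>k. fst (f (length [m] + 2 * k)) = x k \<and> fst (f (Suc (length [m] + 2 * k))) = fst (mv (Suc k))))"
      using resp[of x Z] run(2) unfolding Let_def mv_def[symmetric] by blast
    then obtain f where f: "f \<in> branches S []" "\<And>k. fst (f (Suc (2 * k))) = x k"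
      "\<And>k. fst (f (Suc (Suc (2 * k)))) = fst (mv (Suc k))"
      by auto
    have "outcome x (\<lambda>k. fst (mv (Suc k))) = (\<lambda>m. fst (f (Suc m)))"
    proof
      fix m show "outcome x (\<lambda>k. fst (mv (Suc k))) m = fst (f (Suc m))"
        by (cases "even m") (auto simp: outcome_def f(2) f(3) elim!: evenE oddE)
    qed
    then have "outcome x (\<lambda>k. fst (mv (Suc k))) \<in> B" using W[of f] f(1) S(4) by auto
    then show "(\<forall>k. fst (resp (map (\<lambda>i. (x i, Z i)) [0..<Suc k])) \<in> Z k \<and>
          fst (resp (map (\<lambda>i. (x i, Z i)) [0..<Suc k])) \<noteq> (\<lambda>_. 0)) \<and>
        outcome x (\<lambda>k. fst (resp (map (\<lambda>i. (x i, Z i)) [0..<Suc k]))) \<in> B"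
      using * unfolding mv_def by blast
  qed
  then show ?thesis using X by blast
qed

text \<open>I owns the odd lengths, so the fusion starts at the root and the opening move of II is
  part of the history: it consists of a dummy vector \<open>d\<close> and the subspace
  \<open>Z 0\<close>.\<close>

lemma I_wins_B_if_wins_kastanas:
  fixes B :: "(nat \<Rightarrow> 'f::{field,countable} vec) set"
  assumes w: "wins (\<lambda>r. odd (length r)) kastanas [] W"
    and W: "\<And>f. f \<in> W \<Longrightarrow> f \<in> branches kastanas [] \<Longrightarrow> (\<lambda>m. fst (f (Suc m))) \<in> B"
  shows "\<exists>X. block_subspace X \<and> I_wins_B X B"
proof -
  let ?s = "\<lambda>r :: 'f move list. odd (length r)"
  obtain S where S: "strat ?s kastanas S" "[] \<in> S" "\<And>q n. q \<in> S \<Longrightarrow> take n q \<in> S"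
    "branches S [] \<subseteq> W \<inter> branches kastanas []"
    using wins_kastanas_closedE[OF w] by blast
  obtain X and resp :: "'f move list \<Rightarrow> 'f vec \<times> nat" where X: "block_subspace X"
    and resp: "\<And>v Z. let mv = (\<lambda>k. resp (map (\<lambda>i. (v i, Z i)) [0..<k])) in
      (\<forall>k. block_subspace (Z k) \<and> Z k \<subseteq> X) \<longrightarrow> v 0 \<in> last_space [] \<longrightarrow> v 0 \<noteq> (\<lambda>_. 0) \<longrightarrow>
      (\<forall>k. v (Suc k) \<in> tail_sub X (snd (mv (Suc k)))) \<longrightarrow>
      (\<forall>k. fst (mv (Suc k)) \<in> Z k \<and> fst (mv (Suc k)) \<noteq> (\<lambda>_. 0)) \<and>
      (\<exists>f\<in>branches S []. pre f (length ([] :: 'f move list)) = [] \<and>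
        (\<forall>k. fst (f (length ([] :: 'f move list) + 2 * k)) = v k \<and>
          fst (f (Suc (length ([] :: 'f move list) + 2 * k))) = fst (mv (Suc k))))"
    by (rule fusion_strategy[OF S(1,3), where ?r0.0 = "[]"]) (use S(2) in auto)
  obtain d where d: "d \<in> tail_sub (Evec :: 'f vec set) 0"
    using block_subspace_tail_nonempty[OF block_subspace_univ] by blast
  have "I_wins_B X B"
    unfolding I_wins_B_def Let_def
  proof (intro exI[of _ "\<lambda>Z0 h. resp ((d, Z0) # h)"] allI impI)
    fix y :: "nat \<Rightarrow> 'f vec" and Z
    \<comment> \<open>Prepending the dummy pairs \<open>d\<close> with \<open>Z 0\<close> and
      \<open>y i\<close> with \<open>Z (Suc i)\<close>, as in the histories of
      \<open>B\<^sub>X\<close>.\<close>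
    define u where "u = case_nat d y"
    define mv where "mv = (\<lambda>k. resp (map (\<lambda>i. (u i, Z i)) [0..<k]))"
    have mv: "resp ((d, Z 0) # map (\<lambda>i. (y i, Z (Suc i))) [0..<k]) = mv (Suc k)" for k
      unfolding mv_def u_def by (simp only: upt_conv_Cons zero_less_Suc list.map map_Suc_upt[symmetric]) (simp add: comp_def)
    assume "\<forall>k. block_subspace (Z k) \<and> Z k \<subseteq> X \<and>
        y k \<in> tail_sub X (snd (resp ((d, Z 0) # map (\<lambda>i. (y i, Z (Suc i))) [0..<k])))"
    then have run: "\<And>k. block_subspace (Z k) \<and> Z k \<subseteq> X" "\<And>k. u (Suc k) \<in> tail_sub X (snd (mv (Suc k)))"
      by (simp_all add: mv u_def)
    have "u 0 \<in> last_space []" "u 0 \<noteq> (\<lambda>_. 0)"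
      using d by (simp_all add: u_def last_space_def tail_sub_def)
    then have *: "(\<forall>k. fst (mv (Suc k)) \<in> Z k \<and> fst (mv (Suc k)) \<noteq> (\<lambda>_. 0)) \<and>
      (\<exists>f\<in>branches S []. pre f (length ([] :: 'f move list)) = [] \<and>
        (\<forall>k. fst (f (length ([] :: 'f move list) + 2 * k)) = u k \<and>
          fst (f (Suc (length ([] :: 'f move list) + 2 * k))) = fst (mv (Suc k))))"
      using resp[of u Z] run unfolding Let_def mv_def[symmetric] by blast
    then obtain f where f: "f \<in> branches S []" "\<And>k. fst (f (2 * k)) = u k"
      "\<And>k. fst (f (Suc (2 * k))) = fst (mv (Suc k))"
      by auto
    have "fst (f (Suc (Suc (2 * k)))) = y k" for k
      using f(2)[of "Suc k"] by (simp add: u_def)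
    then have "outcome (\<lambda>k. fst (mv (Suc k))) y = (\<lambda>m. fst (f (Suc m)))"
      by (intro ext) (auto simp: outcome_def f(3) elim!: evenE oddE)
    then have "outcome (\<lambda>k. fst (mv (Suc k))) y \<in> B" using W[of f] f(1) S(4) by auto
    then show "(\<forall>k. fst (resp ((d, Z 0) # map (\<lambda>i. (y i, Z (Suc i))) [0..<k])) \<in> Z k \<and>
          fst (resp ((d, Z 0) # map (\<lambda>i. (y i, Z (Suc i))) [0..<k])) \<noteq> (\<lambda>_. 0)) \<and>
        outcome (\<lambda>k. fst (resp ((d, Z 0) # map (\<lambda>i. (y i, Z (Suc i))) [0..<k]))) y \<in> B"
      using * unfolding mv by blast
  qed
  then show ?thesis using X by blast
qed

section \<open>Open sets of outcomes as sets of finite positions\<close>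

lemma topspace_Einf_top: "topspace Einf_top = Einf"
  by (auto simp: Einf_top_def Einf_def PiE_def Pi_def)

lemma openin_Einf_top_agree:
  assumes U: "openin Einf_top U" and s: "s \<in> U"
  obtains n where "\<And>g. g \<in> Einf \<Longrightarrow> (\<And>m. m < n \<Longrightarrow> g m = s m) \<Longrightarrow> g \<in> U"
proof -
  obtain V where V: "finite {i. V i \<noteq> Evec}" "s \<in> Pi\<^sub>E UNIV V" "Pi\<^sub>E UNIV V \<subseteq> U"
    using U s unfolding Einf_top_def openin_product_topology_alt by auto
  define n where "n = Suc (Max (insert 0 {i. V i \<noteq> Evec}))"
  have "g \<in> U" if g: "g \<in> Einf" "\<And>m. m < n \<Longrightarrow> g m = s m" for g
  proof -
    have "g i \<in> V i" for i
    proof (cases "V i = Evec")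
      case True
      then show ?thesis using g(1) by (simp add: Einf_def)
    next
      case False
      then have "i < n"
        using V(1) Max_ge[of "insert 0 {i. V i \<noteq> Evec}" i] unfolding n_def
        by (simp add: less_Suc_eq_le)
      then show ?thesis using g(2) V(2) by (metis PiE_mem UNIV_I)
    qed
    then have "g \<in> Pi\<^sub>E UNIV V" by (simp add: PiE_def)
    then show ?thesis using V(3) by blast
  qed
  then show thesis by (rule that)
qed

text \<open>The basic open set given by the vectors played so far is contained in \<open>U\<close>;
  entry \<open>0\<close> of the position is the dummy and is skipped.\<close>

definition decided :: "(nat \<Rightarrow> 'f::zero vec) set \<Rightarrow> 'f move list set" where
  "decided U = {q. \<forall>g\<in>Einf. (\<forall>m. Suc m < length q \<longrightarrow> g m = fst (q ! Suc m)) \<longrightarrow> g \<in> U}"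

lemma decided_snoc: "q \<in> decided U \<Longrightarrow> q @ [m] \<in> decided U"
  by (auto simp: decided_def nth_append)

lemma decided_iff:
  assumes U: "openin Einf_top U" and f: "(\<lambda>m. fst (f (Suc m))) \<in> Einf"
  shows "(\<exists>n. pre f n \<in> decided U) \<longleftrightarrow> (\<lambda>m. fst (f (Suc m))) \<in> U"
proof
  assume "\<exists>n. pre f n \<in> decided U"
  then show "(\<lambda>m. fst (f (Suc m))) \<in> U"
    using f by (auto simp: decided_def pre_def dest!: bspec)
next
  assume "(\<lambda>m. fst (f (Suc m))) \<in> U"
  then obtain n where n: "\<And>g. g \<in> Einf \<Longrightarrow> (\<And>m. m < n \<Longrightarrow> g m = fst (f (Suc m))) \<Longrightarrow> g \<in> U"
    using openin_Einf_top_agree[OF U] by metis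
  have "pre f (Suc n) \<in> decided U"
    using n by (auto simp: decided_def pre_def simp del: upt_Suc)
  then show "\<exists>n. pre f n \<in> decided U" by blast
qed

text \<open>The payoff \<open>W\<close> is stated through finite positions for arbitrary sequences
  of moves. It is compared with \<open>B\<close> on legal runs only, because there the outcome is
  known to lie in \<open>Einf\<close>.\<close>

lemma kastanas_Gdelta_sigma_determined:
  fixes U :: "nat \<Rightarrow> nat \<Rightarrow> (nat \<Rightarrow> 'f::{field,countable} vec) set"
  assumes U: "\<And>i j. openin Einf_top (U i j)" and B: "B = (\<Union>i. \<Inter>j. U i j)"
  shows "\<exists>W. (\<forall>f\<in>branches kastanas []. f \<in> W \<longleftrightarrow> (\<lambda>m. fst (f (Suc m))) \<in> B) \<and>
    (wins t kastanas [] W \<or> wins (\<lambda>q. \<not> t q) kastanas [] (- W))"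
proof -
  define W where "W = {f. \<exists>i. \<forall>j. \<exists>n. pre f n \<in> decided (U i j)}"
  have "f \<in> W \<longleftrightarrow> (\<lambda>m. fst (f (Suc m))) \<in> B" if "f \<in> branches kastanas []" for f
    using decided_iff[OF U kastanas_branch_Einf[OF that]] by (simp add: W_def B)
  moreover have "wins t kastanas [] W \<or> wins (\<lambda>q. \<not> t q) kastanas [] (- W)"
    by (rule Sigma03_determined[OF pruned_kastanas kastanas_Nil decided_snoc W_def])
  ultimately show ?thesis by (intro exI[of _ W] conjI ballI)
qed

theorem theorem1:
  fixes A :: "(nat \<Rightarrow> nat \<Rightarrow> 'f::{field,countable}) set"
  assumes "A \<subseteq> Einf"
    and "Fsigma_delta_in Einf_top A \<or> Gdelta_sigma_in Einf_top A"
  shows "\<exists>X. block_subspace X \<and> (II_wins_A X (Einf - A) \<or> I_wins_B X A)"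
  using assms(2)
proof
  assume "Gdelta_sigma_in Einf_top A"
  then obtain U :: "nat \<Rightarrow> nat \<Rightarrow> (nat \<Rightarrow> 'f vec) set" where U: "\<And>i j. openin Einf_top (U i j)"
    and A: "A = (\<Union>i. \<Inter>j. U i j)"
    by (auto simp: Gdelta_sigma_in_def)
  obtain W where W: "\<forall>f\<in>branches kastanas []. f \<in> W \<longleftrightarrow> (\<lambda>m. fst (f (Suc m))) \<in> A"
    and det: "wins (\<lambda>r. odd (length r)) kastanas [] W \<or> wins (\<lambda>r. \<not> odd (length r)) kastanas [] (- W)"
    using kastanas_Gdelta_sigma_determined[OF U A, of "\<lambda>r. odd (length r)"] by (elim exE conjE) (rule that)
  from det show ?thesis
  proof
    assume "wins (\<lambda>r. odd (length r)) kastanas [] W"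
    then have "\<exists>X. block_subspace X \<and> I_wins_B X A"
      by (rule I_wins_B_if_wins_kastanas) (simp add: W)
    then show ?thesis by blast
  next
    assume "wins (\<lambda>r. \<not> odd (length r)) kastanas [] (- W)"
    then have "wins (\<lambda>r. even (length r)) kastanas [] (- W)" by simp
    then have "\<exists>X. block_subspace X \<and> II_wins_A X (Einf - A)"
      by (rule II_wins_A_if_wins_kastanas) (simp add: W kastanas_branch_Einf)
    then show ?thesis by blast
  qed
next
  assume "Fsigma_delta_in Einf_top A"
  then obtain C :: "nat \<Rightarrow> nat \<Rightarrow> (nat \<Rightarrow> 'f vec) set" where C: "\<And>i j. closedin Einf_top (C i j)"
    and A: "A = (\<Inter>i. \<Union>j. C i j)"
    by (auto simp: Fsigma_delta_in_def)
  define U where "U = (\<lambda>i j. Einf - C i j)"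
  have U: "openin Einf_top (U i j)" for i j
    using C[of i j] by (simp add: closedin_def topspace_Einf_top U_def)
  have co: "Einf - A = (\<Union>i. \<Inter>j. U i j)" unfolding A U_def by blast
  obtain W where W: "\<forall>f\<in>branches kastanas []. f \<in> W \<longleftrightarrow> (\<lambda>m. fst (f (Suc m))) \<in> Einf - A"
    and det: "wins (\<lambda>r. even (length r)) kastanas [] W \<or> wins (\<lambda>r. \<not> even (length r)) kastanas [] (- W)"
    using kastanas_Gdelta_sigma_determined[OF U co, of "\<lambda>r. even (length r)"] by (elim exE conjE) (rule that)
  from det show ?thesis
  proof
    assume "wins (\<lambda>r. even (length r)) kastanas [] W"
    then have "\<exists>X. block_subspace X \<and> II_wins_A X (Einf - A)"
      by (rule II_wins_A_if_wins_kastanas) (simp add: W)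
    then show ?thesis by blast
  next
    assume "wins (\<lambda>r. \<not> even (length r)) kastanas [] (- W)"
    then have "\<exists>X. block_subspace X \<and> I_wins_B X A"
    proof (rule I_wins_B_if_wins_kastanas)
      \<comment> \<open>A legal run has its outcome in \<open>Einf\<close>, so missing
        \<open>Einf - A\<close> means lying in \<open>A\<close>.\<close>
      fix f assume "f \<in> - W" "f \<in> branches kastanas []"
      then show "(\<lambda>m. fst (f (Suc m))) \<in> A" using W kastanas_branch_Einf by blast
    qed
    then show ?thesis by blast
  qed
qed

end
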